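(* Let $\Omega\subset\mathbb{C}^d$ be a bounded domain, let $T$ be a closed subset of $\partial\Omega$, and let $\mathbf{z}_0$ be a fixed point in $\Omega$. Suppose there is a function $H:\Omega\times T\to\mathbb{C}$, holomorphic in the first variable and continuous in the second variable, with $H(\mathbf{z}_0,\cdot)=1$, such that for every function $f\in\mathfrak{H}(\Omega)$ there is a unique non-negative Borel measure $\nu$ on $T$ satisfying $$f(\mathbf{z})=i\operatorname{Im}f(\mathbf{z}_0)+\int_T H(\mathbf{z},\boldsymbol{\zeta})\,d\nu(\boldsymbol{\zeta})\quad\text{for each }\mathbf{z}\in\Omega.\qquad(1)$$ Let $\mathcal{H}$ be a Hilbert space. Then a $\mathcal{B}(\mathcal{H})$-valued function $f$ on $\Omega$ is in $\mathfrak{H}(\Omega,\mathcal{B}(\mathcal{H}))$ if and only if there exists a unique non-negative $\mathcal{B}(\mathcal{H})$-valued bounded regular Borel measure $E$ on $T$ such that $$f(\mathbf{z})=i\operatorname{Im}f(\mathbf{z}_0)+\int_T H(\mathbf{z},\boldsymbol{\zeta})\,dE(\boldsymbol{\zeta})\quad\text{for each }\mathbf{z}\in\Omega.\qquad(2)$$ Moreover, if $M(\Omega,T)$ denotes the class of all non-negative Borel measures $\nu$ on $T$ which give rise to functions in the Herglotz class $\mathfrak{H}(\Omega)$ through formula (1), then the non-negative measure $\Delta\mapsto\langle E(\Delta)h,h\rangle$, defined on Borel subsets $\Delta$ of $T$, is in $M(\Omega,T)$ for every non-zero $h\in\mathcal{H}$.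
   Context: $\mathcal{B}(\mathcal{H})$ is the algebra of bounded operators on the Hilbert space $\mathcal{H}$. The Herglotz class $\mathfrak{H}(\Omega,\mathcal{B}(\mathcal{H}))$ consists of all $\mathcal{B}(\mathcal{H})$-valued functions on $\Omega$ which are holomorphic and have non-negative real part; $\mathfrak{H}(\Omega)$ denotes this class when $\mathcal{H}=\mathbb{C}$. For an operator $A$, $\operatorname{Re}A=(A+A^* )/2$ and $\operatorname{Im}A=(A-A^* )/(2i)$. A non-negative $\mathcal{B}(\mathcal{H})$-valued bounded regular Borel measure $E$ on $T$ is a map assigning to each Borel set $\Delta\subseteq T$ a non-negative operator $E(\Delta)$ such that $E_{h,k}(\Delta)=\langle E(\Delta)h,k\rangle$ defines a regular complex Borel measure for all $h,k\in\mathcal{H}$ and $\sup_\Delta\|E(\Delta)\|<\infty$. For a continuous function $g$ on $T$, $\int_T g\,dE$ is the operator with $\langle(\int_T g\,dE)h,k\rangle=\int_T g\,dE_{h,k}$ for all $h,k\in\mathcal{H}$.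
   Formalization: The "if" direction as stated is false (punctured disc, T = circle with 0, H(z,0)=z0/z, E=δ_0·I); here the condition that the measures ⟨E(·)h,h⟩ lie in M(Ω,T) for all non-zero h is made part of the right-hand side of the equivalence. *)

theory Defs
  imports "HOL-Analysis.Analysis"
begin

text \<open>Complex normed spaces and complex Hilbert spaces, on top of the real classes of the library.\<close>

class complex_normed_vector = real_normed_vector +
  fixes scaleC :: "complex \<Rightarrow> 'a \<Rightarrow> 'a"  (infixr \<open>*\<^sub>C\<close> 75)
  assumes scaleC_add_right: "c *\<^sub>C (x + y) = c *\<^sub>C x + c *\<^sub>C y"
    and scaleC_add_left: "(c + d) *\<^sub>C x = c *\<^sub>C x + d *\<^sub>C x"
    and scaleC_scaleC: "c *\<^sub>C (d *\<^sub>C x) = (c * d) *\<^sub>C x"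
    and scaleC_of_real: "complex_of_real r *\<^sub>C x = r *\<^sub>R x"
    and norm_scaleC: "norm (c *\<^sub>C x) = cmod c * norm x"

text \<open>The inner product is linear in the first argument and conjugate-linear in the second.\<close>

class complex_hilbert_space = complex_normed_vector + complete_space +
  fixes cinner :: "'a \<Rightarrow> 'a \<Rightarrow> complex"
  assumes cinner_commute: "cinner x y = cnj (cinner y x)"
    and cinner_add_left: "cinner (x + y) z = cinner x z + cinner y z"
    and cinner_scaleC_left: "cinner (c *\<^sub>C x) y = c * cinner x y"
    and cinner_self: "cinner x x = complex_of_real ((norm x)\<^sup>2)"

instantiation complex :: complex_hilbert_space
begin

definition scaleC_complex :: "complex \<Rightarrow> complex \<Rightarrow> complex" where
  "scaleC_complex c x = c * x"

definition cinner_complex :: "complex \<Rightarrow> complex \<Rightarrow> complex" where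
  "cinner_complex x y = x * cnj y"

instance
  by standard
    (simp_all add: scaleC_complex_def cinner_complex_def algebra_simps norm_mult
      scaleR_conv_of_real complex_norm_square del: of_real_power)

end

lemma bounded_linear_scaleC:
  "bounded_linear (\<lambda>x :: 'a :: complex_normed_vector. c *\<^sub>C x)"
proof (rule bounded_linear_intro[where K = "cmod c"])
  fix r :: real and x :: 'a
  show "c *\<^sub>C (r *\<^sub>R x) = r *\<^sub>R (c *\<^sub>C x)"
    by (simp add: scaleC_of_real[symmetric] scaleC_scaleC mult.commute)
qed (simp_all add: scaleC_add_right norm_scaleC mult.commute)

instantiation blinfun :: (real_normed_vector, complex_normed_vector) complex_normed_vector
begin

definition scaleC_blinfun :: "complex \<Rightarrow> 'a \<Rightarrow>\<^sub>L 'b \<Rightarrow> 'a \<Rightarrow>\<^sub>L 'b" where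
  "scaleC_blinfun c A = Blinfun (\<lambda>x. c *\<^sub>C blinfun_apply A x)"

lemma scaleC_blinfun_apply: "blinfun_apply (c *\<^sub>C A) x = c *\<^sub>C blinfun_apply A x"
  for A :: "'a \<Rightarrow>\<^sub>L 'b"
  unfolding scaleC_blinfun_def
  by (subst bounded_linear_Blinfun_apply)
    (auto intro: bounded_linear_compose[OF bounded_linear_scaleC] blinfun.bounded_linear_right)

instance
proof
  fix c d :: complex and r :: real and A B :: "'a \<Rightarrow>\<^sub>L 'b"
  show "c *\<^sub>C (A + B) = c *\<^sub>C A + c *\<^sub>C B"
    by (rule blinfun_eqI) (simp add: scaleC_blinfun_apply blinfun.add_left scaleC_add_right)
  show "(c + d) *\<^sub>C A = c *\<^sub>C A + d *\<^sub>C A"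
    by (rule blinfun_eqI) (simp add: scaleC_blinfun_apply blinfun.add_left scaleC_add_left)
  show cd: "c *\<^sub>C (d *\<^sub>C A) = (c * d) *\<^sub>C A" for c d and A :: "'a \<Rightarrow>\<^sub>L 'b"
    by (rule blinfun_eqI) (simp add: scaleC_blinfun_apply scaleC_scaleC)
  show one: "complex_of_real r *\<^sub>C A = r *\<^sub>R A" for r and A :: "'a \<Rightarrow>\<^sub>L 'b"
    by (rule blinfun_eqI) (simp add: scaleC_blinfun_apply scaleC_of_real blinfun.scaleR_left)
  have le: "norm (c *\<^sub>C A) \<le> cmod c * norm A" for c and A :: "'a \<Rightarrow>\<^sub>L 'b"
  proof (rule norm_blinfun_bound)
    fix x
    have "cmod c * norm (blinfun_apply A x) \<le> cmod c * (norm A * norm x)"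
      by (intro mult_left_mono norm_blinfun) simp
    then show "norm (blinfun_apply (c *\<^sub>C A) x) \<le> cmod c * norm A * norm x"
      by (simp add: scaleC_blinfun_apply norm_scaleC mult.assoc)
  qed simp
  show "norm (c *\<^sub>C A) = cmod c * norm A"
  proof (cases "c = 0")
    case True
    then show ?thesis using one[of 0 A] by simp
  next
    case False
    have "norm A = norm (inverse c *\<^sub>C (c *\<^sub>C A))"
      using False one[of 1 A] by (simp add: cd)
    also have "\<dots> \<le> cmod (inverse c) * norm (c *\<^sub>C A)"
      by (rule le)
    finally have "cmod c * norm A \<le> norm (c *\<^sub>C A)"
      using False by (simp add: norm_inverse norm_divide field_simps)
    with le[of c A] show ?thesis by simp
  qed
qed

end

text \<open>The algebra of bounded complex-linear operators, as a subset of the real-linear ones.\<close>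

definition bounded_ops :: "('h :: complex_hilbert_space \<Rightarrow>\<^sub>L 'h) set" where
  "bounded_ops = {A. \<forall>c x. blinfun_apply A (c *\<^sub>C x) = c *\<^sub>C blinfun_apply A x}"

definition op_adjoint :: "'h :: complex_hilbert_space \<Rightarrow>\<^sub>L 'h \<Rightarrow> 'h \<Rightarrow>\<^sub>L 'h" where
  "op_adjoint A = (THE B. B \<in> bounded_ops \<and>
     (\<forall>h k. cinner (blinfun_apply A h) k = cinner h (blinfun_apply B k)))"

definition op_Re :: "'h :: complex_hilbert_space \<Rightarrow>\<^sub>L 'h \<Rightarrow> 'h \<Rightarrow>\<^sub>L 'h" where
  "op_Re A = (1 / 2) *\<^sub>C (A + op_adjoint A)"

definition op_Im :: "'h :: complex_hilbert_space \<Rightarrow>\<^sub>L 'h \<Rightarrow> 'h \<Rightarrow>\<^sub>L 'h" where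
  "op_Im A = (1 / (2 * \<i>)) *\<^sub>C (A - op_adjoint A)"

definition op_nonneg :: "'h :: complex_hilbert_space \<Rightarrow>\<^sub>L 'h \<Rightarrow> bool" where
  "op_nonneg A \<longleftrightarrow> A \<in> bounded_ops \<and>
     (\<forall>h. cinner (blinfun_apply A h) h \<in> \<real> \<and> 0 \<le> Re (cinner (blinfun_apply A h) h))"

text \<open>Holomorphy in several variables: the Frechet derivative exists and is complex-linear.
  For operator-valued functions this is holomorphy in the operator norm. A complex-linear
  derivative of a \<open>bounded_ops\<close>-valued function is automatically \<open>bounded_ops\<close>-valued.\<close>

definition holomorphic_several ::
    "(complex ^ 'd \<Rightarrow> 'b :: complex_normed_vector) \<Rightarrow> (complex ^ 'd) set \<Rightarrow> bool" where
  "holomorphic_several f S \<longleftrightarrow>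
     (\<forall>z\<in>S. \<exists>D. (f has_derivative D) (at z) \<and> (\<forall>c v. D (c *s v) = c *\<^sub>C D v))"

text \<open>Functions on \<open>S\<close> are represented by total functions whose values off \<open>S\<close> are irrelevant.\<close>

definition herglotz :: "(complex ^ 'd) set \<Rightarrow> (complex ^ 'd \<Rightarrow> complex) set" where
  "herglotz S = {f. holomorphic_several f S \<and> (\<forall>z\<in>S. 0 \<le> Re (f z))}"

definition herglotz_op ::
    "(complex ^ 'd) set \<Rightarrow> (complex ^ 'd \<Rightarrow> ('h :: complex_hilbert_space \<Rightarrow>\<^sub>L 'h)) set" where
  "herglotz_op S = {f. f \<in> S \<rightarrow> bounded_ops \<and> holomorphic_several f S \<and>
     (\<forall>z\<in>S. op_nonneg (op_Re (f z)))}"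

abbreviation borel_on :: "'x :: topological_space set \<Rightarrow> 'x measure" where
  "borel_on T \<equiv> restrict_space borel T"

text \<open>Measures representing a function are finite, because the kernel is \<open>1\<close> at the base point.
  This has to be required explicitly, as the integral of a non-integrable function is \<open>0\<close> here.\<close>

definition borel_measures :: "'x :: topological_space set \<Rightarrow> 'x measure set" where
  "borel_measures T = {\<nu>. sets \<nu> = sets (borel_on T) \<and> finite_measure \<nu>}"

definition herglotz_rep ::
    "(complex ^ 'd) set \<Rightarrow> (complex ^ 'd \<Rightarrow> complex ^ 'd \<Rightarrow> complex) \<Rightarrow> complex ^ 'd \<Rightarrow>
     (complex ^ 'd \<Rightarrow> complex) \<Rightarrow> (complex ^ 'd) measure \<Rightarrow> bool" where
  "herglotz_rep S H z\<^sub>0 f \<nu> \<longleftrightarrow>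
     (\<forall>z\<in>S. f z = \<i> * complex_of_real (Im (f z\<^sub>0)) + (\<integral>\<zeta>. H z \<zeta> \<partial>\<nu>))"

text \<open>The class \<open>M(\<Omega>, T)\<close>.\<close>

definition herglotz_measures ::
    "(complex ^ 'd) set \<Rightarrow> (complex ^ 'd) set \<Rightarrow>
     (complex ^ 'd \<Rightarrow> complex ^ 'd \<Rightarrow> complex) \<Rightarrow> complex ^ 'd \<Rightarrow> (complex ^ 'd) measure set" where
  "herglotz_measures S T H z\<^sub>0 =
     {\<nu> \<in> borel_measures T. \<exists>f\<in>herglotz S. herglotz_rep S H z\<^sub>0 f \<nu>}"

text \<open>Complex measures are set functions on the Borel subsets of \<open>T\<close>; regularity of a complex
  measure is regularity of its total variation (as in Rudin, Real and Complex Analysis, ch. 6).\<close>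

definition complex_borel_measure ::
    "'x :: topological_space set \<Rightarrow> ('x set \<Rightarrow> complex) \<Rightarrow> bool" where
  "complex_borel_measure T \<mu> \<longleftrightarrow>
     (\<forall>A :: nat \<Rightarrow> 'x set. range A \<subseteq> sets (borel_on T) \<longrightarrow> disjoint_family A \<longrightarrow>
        (\<lambda>n. \<mu> (A n)) sums \<mu> (\<Union>n. A n))"

definition total_variation ::
    "'x :: topological_space set \<Rightarrow> ('x set \<Rightarrow> complex) \<Rightarrow> 'x set \<Rightarrow> ennreal" where
  "total_variation T \<mu> \<Delta> =
     (SUP A \<in> {A :: nat \<Rightarrow> 'x set. range A \<subseteq> sets (borel_on T) \<and> disjoint_family A \<and>
        (\<Union>n. A n) = \<Delta>}. \<Sum>n. ennreal (cmod (\<mu> (A n))))"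

definition regular_complex_borel_measure ::
    "'x :: topological_space set \<Rightarrow> ('x set \<Rightarrow> complex) \<Rightarrow> bool" where
  "regular_complex_borel_measure T \<mu> \<longleftrightarrow> complex_borel_measure T \<mu> \<and>
     (\<forall>\<Delta> \<in> sets (borel_on T).
        total_variation T \<mu> \<Delta> =
          (INF U \<in> {U. openin (top_of_set T) U \<and> \<Delta> \<subseteq> U}. total_variation T \<mu> U) \<and>
        total_variation T \<mu> \<Delta> =
          (SUP K \<in> {K. compact K \<and> K \<subseteq> \<Delta>}. total_variation T \<mu> K))"

text \<open>Integration against a complex measure, via the Jordan decompositions of its real and
  imaginary parts. The positive part of a finite signed measure \<open>\<sigma>\<close> is
  \<open>\<Delta> \<mapsto> sup {\<sigma> B | B \<subseteq> \<Delta>}\<close>; negative values \<open>\<sigma> B\<close> are cut off by \<open>ennreal\<close>, which is harmless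
  since \<open>\<sigma> {} = 0\<close>. The negative part of \<open>\<sigma>\<close> is the positive part of \<open>-\<sigma>\<close>.\<close>

definition pos_part ::
    "'x :: topological_space set \<Rightarrow> ('x set \<Rightarrow> real) \<Rightarrow> 'x measure" where
  "pos_part T \<sigma> = measure_of T (sets (borel_on T))
     (\<lambda>\<Delta>. SUP B \<in> {B \<in> sets (borel_on T). B \<subseteq> \<Delta>}. ennreal (\<sigma> B))"

definition signed_integral ::
    "'x :: topological_space set \<Rightarrow> ('x set \<Rightarrow> real) \<Rightarrow> ('x \<Rightarrow> complex) \<Rightarrow> complex" where
  "signed_integral T \<sigma> g =
     (\<integral>x. g x \<partial>pos_part T \<sigma>) - (\<integral>x. g x \<partial>pos_part T (\<lambda>B. - \<sigma> B))"

definition complex_integral ::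
    "'x :: topological_space set \<Rightarrow> ('x set \<Rightarrow> complex) \<Rightarrow> ('x \<Rightarrow> complex) \<Rightarrow> complex" where
  "complex_integral T \<mu> g =
     signed_integral T (\<lambda>B. Re (\<mu> B)) g + \<i> * signed_integral T (\<lambda>B. Im (\<mu> B)) g"

text \<open>Operator-valued measures are set functions; \<open>extensional\<close> fixes their values on sets that are
  not Borel subsets of \<open>T\<close>, so that equality of functions is equality of measures.\<close>

definition matrix_measure ::
    "('x set \<Rightarrow> ('h :: complex_hilbert_space \<Rightarrow>\<^sub>L 'h)) \<Rightarrow> 'h \<Rightarrow> 'h \<Rightarrow> 'x set \<Rightarrow> complex" where
  "matrix_measure E h k \<Delta> = cinner (blinfun_apply (E \<Delta>) h) k"

definition nonneg_op_measure ::
    "'x :: topological_space set \<Rightarrow> ('x set \<Rightarrow> ('h :: complex_hilbert_space \<Rightarrow>\<^sub>L 'h)) \<Rightarrow> bool" where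
  "nonneg_op_measure T E \<longleftrightarrow>
     E \<in> extensional (sets (borel_on T)) \<and>
     (\<forall>\<Delta>\<in>sets (borel_on T). op_nonneg (E \<Delta>)) \<and>
     (\<forall>h k. regular_complex_borel_measure T (matrix_measure E h k)) \<and>
     bdd_above ((\<lambda>\<Delta>. norm (E \<Delta>)) ` sets (borel_on T))"

definition op_integral ::
    "'x :: topological_space set \<Rightarrow> ('x set \<Rightarrow> ('h :: complex_hilbert_space \<Rightarrow>\<^sub>L 'h)) \<Rightarrow>
     ('x \<Rightarrow> complex) \<Rightarrow> 'h \<Rightarrow>\<^sub>L 'h" where
  "op_integral T E g = (THE A. A \<in> bounded_ops \<and>
     (\<forall>h k. cinner (blinfun_apply A h) k = complex_integral T (matrix_measure E h k) g))"

definition herglotz_op_rep ::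
    "(complex ^ 'd) set \<Rightarrow> (complex ^ 'd) set \<Rightarrow>
     (complex ^ 'd \<Rightarrow> complex ^ 'd \<Rightarrow> complex) \<Rightarrow> complex ^ 'd \<Rightarrow>
     (complex ^ 'd \<Rightarrow> ('h :: complex_hilbert_space \<Rightarrow>\<^sub>L 'h)) \<Rightarrow>
     ((complex ^ 'd) set \<Rightarrow> ('h \<Rightarrow>\<^sub>L 'h)) \<Rightarrow> bool" where
  "herglotz_op_rep S T H z\<^sub>0 f E \<longleftrightarrow>
     (\<forall>z\<in>S. f z = \<i> *\<^sub>C op_Im (f z\<^sub>0) + op_integral T E (H z))"

definition diagonal_measure ::
    "'x :: topological_space set \<Rightarrow> ('x set \<Rightarrow> ('h :: complex_hilbert_space \<Rightarrow>\<^sub>L 'h)) \<Rightarrow> 'h \<Rightarrow>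
     'x measure" where
  "diagonal_measure T E h = measure_of T (sets (borel_on T))
     (\<lambda>\<Delta>. ennreal (Re (cinner (blinfun_apply (E \<Delta>) h) h)))"

end

theory Submission
  imports Defs "HOL-Complex_Analysis.Complex_Analysis"
begin

text \<open>For a Herglotz function \<open>f\<close> with operator values, each scalar function \<open>\<langle>f(\<cdot>)h, h\<rangle>\<close> is represented by
  a unique measure \<open>\<nu>\<^sub>h\<close>. Uniqueness turns every linear relation among quadratic forms into the same
  relation among the \<open>\<nu>\<^sub>h\<close>, so polarization of \<open>\<nu>\<^sub>h(\<Delta>)\<close> yields a sesquilinear form, bounded because
  \<open>\<nu>\<^sub>h(T) = Re \<langle>f(z\<^sub>0)h, h\<rangle>\<close>, and the Riesz representation theorem turns it into \<open>E(\<Delta>)\<close>. Conversely,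
  membership of the diagonal measures in \<open>M(\<Omega>, T)\<close> makes all \<open>\<langle>f(\<cdot>)h, h\<rangle>\<close> Herglotz functions, and
  a weakly holomorphic family with non-negative real part is holomorphic in norm.\<close>

section \<open>Complex Hilbert spaces\<close>

text \<open>The uniqueness hypothesis speaks of non-negative measures, while polarization combines
  them with complex coefficients, and the Jordan decomposition behind
  \<open>complex_integral\<close> is not additive in the measure. Relations among measures are
  therefore written as vanishing sums of positive measures with coefficients, and in this form they
  pass to integrals. The representation formula itself is tested on the diagonal, where every
  integral is taken against an ordinary positive measure. In the converse, a non-negative E with the
  integral formula does not suffice for the argument: no hypothesis makes Re H(z, \<zeta>)
  non-negative and none bounds H locally uniformly in z, so neither positivity nor holomorphy of the
  integral can be read off from the kernel. Membership in M(\<Omega>, T) supplies both at once.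
  Bounds of forms come from polarization in place of the Cauchy-Schwarz inequality, which accounts
  for most factors 4 in the constants.\<close>

lemma scaleC_zero_left [simp]: "0 *\<^sub>C x = (0 :: 'a :: complex_normed_vector)"
  using scaleC_of_real[of 0 x] by simp

lemma scaleC_one [simp]: "1 *\<^sub>C x = (x :: 'a :: complex_normed_vector)"
  using scaleC_of_real[of 1 x] by simp

lemma scaleC_minus_one [simp]: "(- 1) *\<^sub>C x = - (x :: 'a :: complex_normed_vector)"
  using scaleC_of_real[of "-1" x] by simp

lemma scaleC_zero_right [simp]: "c *\<^sub>C 0 = (0 :: 'a :: complex_normed_vector)"
  using scaleC_scaleC[of c 0 0] by simp

section \<open>Sesquilinear forms and polarization\<close>

definition sesquilinear ::
    "('h :: complex_normed_vector \<Rightarrow> 'h \<Rightarrow> complex) \<Rightarrow> bool" where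
  "sesquilinear B \<longleftrightarrow>
     (\<forall>x y z. B (x + y) z = B x z + B y z) \<and> (\<forall>c x z. B (c *\<^sub>C x) z = c * B x z) \<and>
     (\<forall>x y z. B x (y + z) = B x y + B x z) \<and> (\<forall>c x z. B x (c *\<^sub>C z) = cnj c * B x z)"

lemma sesquilinearD:
  assumes "sesquilinear B"
  shows "B (x + y) z = B x z + B y z" "B (c *\<^sub>C x) z = c * B x z"
    "B x (y + z) = B x y + B x z" "B x (c *\<^sub>C z) = cnj c * B x z"
    "B 0 z = 0" "B x 0 = 0" "B (- x) z = - B x z" "B x (- z) = - B x z"
    "B (x - y) z = B x z - B y z" "B x (y - z) = B x y - B x z"
proof -
  show *: "B (x + y) z = B x z + B y z" "B (c *\<^sub>C x) z = c * B x z"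
    "B x (y + z) = B x y + B x z" "B x (c *\<^sub>C z) = cnj c * B x z" for x y z c
    using assms by (auto simp: sesquilinear_def)
  show "B 0 z = 0" "B x 0 = 0" using *(2)[of 0 0 z] *(4)[of x 0 0] by simp_all
  show m: "B (- x) z = - B x z" "B x (- z) = - B x z" for x z
    using *(2)[of "-1" x z] *(4)[of x "-1" z] by simp_all
  show "B (x - y) z = B x z - B y z" "B x (y - z) = B x y - B x z"
    using *(1)[of x "- y" z] *(3)[of x y "- z"] by (simp_all add: m)
qed

lemma sesquilinear_cinner: "sesquilinear (cinner :: 'h :: complex_hilbert_space \<Rightarrow> _)"
  unfolding sesquilinear_def
proof (intro conjI allI)
  fix x y z :: 'h and c
  show "cinner (x + y) z = cinner x z + cinner y z" "cinner (c *\<^sub>C x) z = c * cinner x z"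
    by (rule cinner_add_left cinner_scaleC_left)+
  show "cinner x (y + z) = cinner x y + cinner x z"
    by (subst (1 2 3) cinner_commute) (simp add: cinner_add_left)
  show "cinner x (c *\<^sub>C z) = cnj c * cinner x z"
    by (subst (1 2) cinner_commute) (simp add: cinner_scaleC_left)
qed

lemmas cinner_simps = sesquilinearD[OF sesquilinear_cinner]

text \<open>The vectors of the polarization identity; the factor \<open>1/2\<close> absorbs its factor \<open>1/4\<close>.\<close>

definition polar_vec :: "'h \<Rightarrow> 'h \<Rightarrow> nat \<Rightarrow> 'h :: complex_normed_vector" where
  "polar_vec h k n = (1 / 2) *\<^sub>C (h + \<i> ^ n *\<^sub>C k)"

lemma sum_lessThan_4: "(\<Sum>n<(4::nat). F n) = F 0 + F 1 + F 2 + (F 3 :: 'a :: comm_monoid_add)"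
  by (simp add: eval_nat_numeral add.assoc)

text \<open>The weights cancel every term of the expansion except B h k, because the powers of i and
  their squares sum to 0. No symmetry or positivity of \<open>B\<close> enters, so the identity also
  serves derivatives and integrals that depend sesquilinearly on two vectors.\<close>

lemma polarization:
  assumes "sesquilinear B"
  shows "B h k = (\<Sum>n<4. \<i> ^ n * B (polar_vec h k n) (polar_vec h k n))"
proof -
  have i3: "\<i> ^ 3 = - \<i>" by (simp add: power3_eq_cube)
  show ?thesis
    by (simp add: sum_lessThan_4 i3 polar_vec_def sesquilinearD[OF assms])
      (simp add: field_simps)
qed

lemma norm_polar_vec_le: "norm (polar_vec h k n) \<le> (norm h + norm k) / 2"
  using norm_triangle_ineq[of h "\<i> ^ n *\<^sub>C k"]
  by (simp add: polar_vec_def norm_scaleC norm_power norm_divide)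

text \<open>For unit vectors every polarization vector has norm at most 1, so each of the four terms
  is at most \<open>M\<close>. Unlike the Cauchy-Schwarz inequality, this argument works for forms
  that are not positive.\<close>

lemma sesquilinear_bounded:
  assumes B: "sesquilinear B" and q: "\<And>h. cmod (B h h) \<le> M * (norm h)\<^sup>2"
  shows "cmod (B h k) \<le> 4 * M * norm h * norm k"
proof (cases "h = 0 \<or> k = 0")
  case True
  then show ?thesis by (auto simp: sesquilinearD[OF B])
next
  case False
  have M: "0 \<le> M" using q[of h] False
    by (metis norm_ge_zero order_trans zero_le_mult_iff zero_less_norm_iff zero_less_power
        linorder_not_less)
  define x where "x = complex_of_real (inverse (norm h)) *\<^sub>C h"
  define y where "y = complex_of_real (inverse (norm k)) *\<^sub>C k"
  have n: "norm x = 1" "norm y = 1"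
    using False by (simp_all add: x_def y_def norm_scaleC norm_inverse)
  have xy: "B x y = B h k / (norm h * norm k)"
    by (simp add: x_def y_def sesquilinearD[OF B] field_simps)
  have "cmod (B x y) \<le> (\<Sum>n<(4::nat). M)"
    unfolding polarization[OF B, of x y]
  proof (rule order_trans[OF norm_sum], rule sum_mono)
    fix n
    have "norm (polar_vec x y n) \<le> 1" using norm_polar_vec_le[of x y n] n by simp
    then have "M * (norm (polar_vec x y n))\<^sup>2 \<le> M * 1"
      by (intro mult_left_mono M) (simp add: power_le_one)
    then show "cmod (\<i> ^ n * B (polar_vec x y n) (polar_vec x y n)) \<le> M"
      using q[of "polar_vec x y n"] by (simp add: norm_mult norm_power)
  qed
  then show ?thesis
    using False by (simp add: xy norm_divide norm_mult field_simps)
qed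

text \<open>Cauchy-Schwarz up to the factor 4 of \<open>sesquilinear_bounded\<close>; only
  boundedness matters later, not the sharp constant.\<close>

lemma cinner_bound: "cmod (cinner x y) \<le> 4 * norm x * norm y"
  using sesquilinear_bounded[OF sesquilinear_cinner, of 1 x y] by (simp add: cinner_self norm_power)

lemma bounded_linear_cinner_left: "bounded_linear (\<lambda>x. cinner x y)"
proof (rule bounded_linear_intro[where K = "4 * norm y"])
  fix r x show "cinner (r *\<^sub>R x) y = r *\<^sub>R cinner x y"
    by (simp add: scaleC_of_real[symmetric] cinner_simps scaleC_complex_def)
qed (use cinner_bound[of _ y] in \<open>auto simp: cinner_simps algebra_simps\<close>)

lemma cinner_ext: "(\<And>k. cinner x k = cinner y k) \<Longrightarrow> x = y"
proof -
  assume "\<And>k. cinner x k = cinner y k"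
  then have "cinner (x - y) (x - y) = 0" by (simp add: cinner_simps)
  then show ?thesis by (simp add: cinner_self)
qed

section \<open>Geometry of the norm and the Riesz representation theorem\<close>

lemma norm_add_sq:
  "(norm (x + y))\<^sup>2 = (norm x)\<^sup>2 + (norm y)\<^sup>2 + 2 * Re (cinner x (y :: 'h :: complex_hilbert_space))"
proof -
  have "complex_of_real ((norm (x + y))\<^sup>2) = cinner x x + cinner y y + (cinner x y + cinner y x)"
    by (simp add: cinner_self[symmetric] cinner_simps algebra_simps del: of_real_power)
  also have "cinner x y + cinner y x = complex_of_real (2 * Re (cinner x y))"
    by (subst (2) cinner_commute) (simp add: complex_eq_iff)
  finally show ?thesis
    by (simp only: cinner_self of_real_add[symmetric] of_real_eq_iff)
qed

lemma parallelogram: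
  "(norm (x + y))\<^sup>2 + (norm (x - y))\<^sup>2 = 2 * (norm x)\<^sup>2 + 2 * (norm (y :: 'h :: complex_hilbert_space))\<^sup>2"
  using norm_add_sq[of x y] norm_add_sq[of x "- y"] by (simp add: cinner_simps)

text \<open>The representing vector is a multiple of the point \<open>u\<close> of least norm on the
  affine hyperplane where \<phi> is 1: \<open>u\<close> is orthogonal to the kernel of \<phi>, and x
  - \<phi>(x) u always lies in that kernel.\<close>

lemma riesz_representation:
  fixes \<phi> :: "'h :: complex_hilbert_space \<Rightarrow> complex"
  assumes add: "\<And>x y. \<phi> (x + y) = \<phi> x + \<phi> y" and scale: "\<And>c x. \<phi> (c *\<^sub>C x) = c * \<phi> x"
    and bound: "\<And>x. cmod (\<phi> x) \<le> C * norm x"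
  shows "\<exists>y. \<forall>x. \<phi> x = cinner x y"
proof (cases "\<forall>x. \<phi> x = 0")
  case True
  then show ?thesis by (intro exI[of _ 0]) (simp add: cinner_simps)
next
  case False
  have \<phi>0: "\<phi> 0 = 0" using scale[of 0 0] by simp
  have minus: "\<phi> (- x) = - \<phi> x" for x using scale[of "-1" x] by simp
  have bl: "bounded_linear \<phi>"
  proof (rule bounded_linear_intro[where K = C])
    fix r x show "\<phi> (r *\<^sub>R x) = r *\<^sub>R \<phi> x"
      by (simp add: scaleC_of_real[symmetric] scale scaleC_complex_def)
  qed (use add bound in \<open>auto simp: mult.commute\<close>)
  from False obtain x0 where x0: "\<phi> x0 \<noteq> 0" by blast
  define S where "S = {x. \<phi> x = 1}"
  have "inverse (\<phi> x0) *\<^sub>C x0 \<in> S" using x0 by (simp add: S_def scale)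
  then have ne: "S \<noteq> {}" by blast
  define d where "d = (INF x\<in>S. (norm x)\<^sup>2)"
  have bdd: "bdd_below ((\<lambda>x. (norm x)\<^sup>2) ` S)" by (rule bdd_belowI[of _ 0]) auto
  have d_le: "d \<le> (norm x)\<^sup>2" if "x \<in> S" for x
    unfolding d_def by (rule cINF_lower[OF bdd that])
  have mid: "4 * d \<le> (norm (x + y))\<^sup>2" if "x \<in> S" "y \<in> S" for x y
  proof -
    have "(1 / 2) *\<^sub>C (x + y) \<in> S" using that by (simp add: S_def scale add)
    from d_le[OF this] show ?thesis by (simp add: norm_scaleC norm_divide power_divide)
  qed
  have "\<exists>x\<in>S. (norm x)\<^sup>2 < d + 1 / Suc n" for n
    using cInf_lessD[of "(\<lambda>x. (norm x)\<^sup>2) ` S" "d + 1 / Suc n"] ne by (auto simp: d_def)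
  then obtain X where X: "X n \<in> S" "(norm (X n))\<^sup>2 < d + 1 / Suc n" for n by metis
  \<comment> \<open>Midpoints stay in \<open>S\<close>, so the squared norm of the sum is at least
    4d. In the parallelogram law the contributions 2d + 2d - 4d cancel and only the errors
    remain.\<close>
  have dist2: "(norm (X m - X n))\<^sup>2 \<le> 2 * (1 / Suc m) + 2 * (1 / Suc n)" for m n
    using parallelogram[of "X m" "X n"] mid[OF X(1) X(1), of m n] X(2)[of m] X(2)[of n]
    by linarith
  have "Cauchy X"
  proof (rule metric_CauchyI)
    fix e :: real assume "0 < e"
    then obtain N where N: "4 / e\<^sup>2 < real N" using reals_Archimedean2 by blast
    show "\<exists>M. \<forall>m\<ge>M. \<forall>n\<ge>M. dist (X m) (X n) < e"
    proof (intro exI[of _ N] allI impI)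
      fix m n assume mn: "N \<le> m" "N \<le> n"
      have "2 / Suc m \<le> 2 / Suc N" "2 / Suc n \<le> 2 / Suc N"
        using mn by (auto intro!: divide_left_mono)
      moreover have "4 / real (Suc N) < e\<^sup>2"
      proof -
        have "4 < real N * e\<^sup>2" using N \<open>0 < e\<close> by (simp add: field_simps)
        also have "\<dots> \<le> real (Suc N) * e\<^sup>2" by (intro mult_right_mono) auto
        finally show ?thesis by (simp add: field_simps)
      qed
      ultimately have "(norm (X m - X n))\<^sup>2 < e\<^sup>2" using dist2[of m n] by simp
      then show "dist (X m) (X n) < e"
        using \<open>0 < e\<close> by (simp add: dist_norm power_less_imp_less_base)
    qed
  qed
  then obtain u where u: "X \<longlonglongrightarrow> u" using Cauchy_convergent convergent_def by blast
  have "(\<lambda>n. \<phi> (X n)) \<longlonglongrightarrow> \<phi> u" by (rule bounded_linear.tendsto[OF bl u])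
  moreover have "\<phi> (X n) = 1" for n using X(1)[of n] by (simp add: S_def)
  ultimately have u1: "\<phi> u = 1" by (simp add: LIMSEQ_const_iff)
  have "(\<lambda>n. (norm (X n))\<^sup>2) \<longlonglongrightarrow> (norm u)\<^sup>2" by (intro tendsto_intros u)
  moreover have "(\<lambda>n. d + 1 / Suc n) \<longlonglongrightarrow> d + 0"
    by (intro tendsto_intros LIMSEQ_Suc[OF lim_1_over_n])
  ultimately have ud: "(norm u)\<^sup>2 \<le> d"
    using X(2) by (intro LIMSEQ_le) (auto intro: less_imp_le)
  have Re0: "Re (cinner u v) = 0" if v: "\<phi> v = 0" for v
  proof (rule ccontr)
    assume ne0: "Re (cinner u v) \<noteq> 0"
    then have v0: "v \<noteq> 0" by (auto simp: cinner_simps)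
    \<comment> \<open>This t minimises the quadratic t^2 |v|^2 + 2 t Re <u, v>, whose minimum is
      negative unless the real part vanishes.\<close>
    define t where "t = - Re (cinner u v) / (norm v)\<^sup>2"
    have "u + complex_of_real t *\<^sub>C v \<in> S" using u1 v by (simp add: S_def add scale)
    from order_trans[OF ud d_le[OF this]] have "0 \<le> t\<^sup>2 * (norm v)\<^sup>2 + 2 * (t * Re (cinner u v))"
      by (simp add: norm_add_sq norm_scaleC power_mult_distrib cinner_simps)
    also have "\<dots> = - (Re (cinner u v))\<^sup>2 / (norm v)\<^sup>2"
      using v0 by (simp add: t_def field_simps power2_eq_square)
    also have "\<dots> < 0" using v0 ne0 by (simp add: divide_neg_pos)
    finally show False by simp
  qed
  have orth: "cinner v u = 0" if v: "\<phi> v = 0" for v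
  proof -
    \<comment> \<open>Replacing v by i v turns the imaginary part of the product into a real
      part.\<close>
    have "cinner u v = 0"
      using Re0[OF v] Re0[of "\<i> *\<^sub>C v"] v by (simp add: scale cinner_simps complex_eq_iff)
    then show ?thesis by (subst cinner_commute) simp
  qed
  have u0: "u \<noteq> 0" using u1 \<phi>0 by auto
  have "\<phi> x = cinner x (complex_of_real (1 / (norm u)\<^sup>2) *\<^sub>C u)" for x
  proof -
    have "\<phi> (x - \<phi> x *\<^sub>C u) = 0"
      using add[of x "- (\<phi> x *\<^sub>C u)"] u1 by (simp add: minus scale)
    from orth[OF this] have "cinner x u = \<phi> x * complex_of_real ((norm u)\<^sup>2)"
      by (simp add: cinner_simps cinner_self)
    then show ?thesis using u0 by (simp add: cinner_simps)
  qed
  then show ?thesis by blast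
qed

section \<open>Complex-linear operators, their forms and adjoints\<close>

lemma bounded_opsD: "A \<in> bounded_ops \<Longrightarrow> A (c *\<^sub>C x) = c *\<^sub>C A x"
  by (simp add: bounded_ops_def)

lemma bounded_ops_add: "A \<in> bounded_ops \<Longrightarrow> B \<in> bounded_ops \<Longrightarrow> A + B \<in> bounded_ops"
  by (simp add: bounded_ops_def blinfun.add_left scaleC_add_right)

lemma bounded_ops_scaleC: "A \<in> bounded_ops \<Longrightarrow> c *\<^sub>C A \<in> bounded_ops"
  by (simp add: bounded_ops_def scaleC_blinfun_apply scaleC_scaleC mult.commute)

lemma bounded_ops_diff: "A \<in> bounded_ops \<Longrightarrow> B \<in> bounded_ops \<Longrightarrow> A - B \<in> bounded_ops"
  using bounded_ops_add[of A "- 1 *\<^sub>C B"] bounded_ops_scaleC[of B "-1"] by simp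

lemma sesquilinear_op: "A \<in> bounded_ops \<Longrightarrow> sesquilinear (\<lambda>h k. cinner (blinfun_apply A h) k)"
  by (auto simp: sesquilinear_def blinfun.add_right cinner_simps bounded_opsD)

lemma op_ext: "(\<And>h k. cinner (blinfun_apply A h) k = cinner (blinfun_apply B h) k) \<Longrightarrow> A = B"
  by (rule blinfun_eqI) (rule cinner_ext)

text \<open>Polarization recovers the whole form from its diagonal. This reduces the representation
  formula and the uniqueness of E to scalar measures.\<close>

lemma op_ext_diag:
  assumes "A \<in> bounded_ops" "B \<in> bounded_ops"
    and "\<And>h. cinner (blinfun_apply A h) h = cinner (blinfun_apply B h) h"
  shows "A = B"
proof (rule op_ext)
  fix h k
  show "cinner (blinfun_apply A h) k = cinner (blinfun_apply B h) k"
    unfolding polarization[OF sesquilinear_op[OF assms(1)], of h k]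
      polarization[OF sesquilinear_op[OF assms(2)], of h k] assms(3) ..
qed

lemma norm_op_le:
  assumes "\<And>h k. cmod (cinner (blinfun_apply A h) k) \<le> M * norm h * norm k" and "0 \<le> M"
  shows "norm A \<le> M"
proof (rule norm_blinfun_bound[OF assms(2)])
  fix h
  have "norm (A h) * norm (A h) \<le> M * norm h * norm (A h)"
    using assms(1)[of h "A h"] by (simp add: cinner_self power2_eq_square norm_mult)
  then show "norm (A h) \<le> M * norm h" using assms(2) by (cases "A h = 0") auto
qed

text \<open>Riesz needs a linear functional, and B h k is conjugate-linear in k; hence its conjugate
  is represented. This is the single passage from forms to operators: adjoints, operator integrals,
  the values of E and the derivative of f are all obtained through it.\<close>

lemma op_of_form:
  fixes B :: "'h :: complex_hilbert_space \<Rightarrow> 'h \<Rightarrow> complex"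
  assumes B: "sesquilinear B" and q: "\<And>h. cmod (B h h) \<le> M * (norm h)\<^sup>2"
  obtains A where "A \<in> bounded_ops" "\<And>h k. cinner (blinfun_apply A h) k = B h k"
proof -
  note bd = sesquilinear_bounded[OF B q]
  have "\<exists>y. \<forall>k. cnj (B h k) = cinner k y" for h
    by (rule riesz_representation[where C = "4 * M * norm h"])
      (use bd[of h] in \<open>simp_all add: sesquilinearD[OF B]\<close>)
  then obtain F where F: "cnj (B h k) = cinner k (F h)" for h k by metis
  have F': "cinner (F h) k = B h k" for h k
    by (subst cinner_commute) (simp add: F[symmetric])
  have add: "F (x + y) = F x + F y" for x y
    by (rule cinner_ext) (simp add: F' cinner_simps sesquilinearD[OF B])
  have scale: "F (c *\<^sub>C x) = c *\<^sub>C F x" for c x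
    by (rule cinner_ext) (simp add: F' cinner_simps sesquilinearD[OF B])
  have "bounded_linear F"
  proof (rule bounded_linear_intro[where K = "\<bar>4 * M\<bar>"])
    fix r x show "F (r *\<^sub>R x) = r *\<^sub>R F x"
      by (simp add: scaleC_of_real[symmetric] scale)
  next
    fix x
    have "norm (F x) * norm (F x) = cmod (B x (F x))"
      by (simp add: F'[symmetric] cinner_self power2_eq_square norm_mult)
    also have "\<dots> \<le> 4 * M * norm x * norm (F x)" by (rule bd)
    also have "\<dots> \<le> \<bar>4 * M\<bar> * norm x * norm (F x)" by (intro mult_right_mono) auto
    finally show "norm (F x) \<le> norm x * \<bar>4 * M\<bar>"
      by (cases "F x = 0") (auto simp: mult.commute)
  qed (rule add)
  then show ?thesis
    by (intro that[of "Blinfun F"]) (auto simp: bounded_linear_Blinfun_apply bounded_ops_def scale F')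
qed

lemma norm_cinner_op_le: "cmod (cinner (blinfun_apply A h) h) \<le> 4 * norm A * (norm h)\<^sup>2"
proof -
  have "cmod (cinner (A h) h) \<le> 4 * norm (A h) * norm h" by (rule cinner_bound)
  also have "\<dots> \<le> 4 * (norm A * norm h) * norm h"
    by (intro mult_right_mono mult_left_mono norm_blinfun) auto
  finally show ?thesis by (simp add: power2_eq_square mult.assoc)
qed

text \<open>\<open>op_adjoint\<close> is a definite description, so nothing is known about it before
  unique existence. Existence represents the form <h, A k>, written below as the conjugate of <A k,
  h>.\<close>

lemma op_adjoint:
  fixes A :: "'h :: complex_hilbert_space \<Rightarrow>\<^sub>L 'h"
  assumes A: "A \<in> bounded_ops"
  shows "op_adjoint A \<in> bounded_ops"
    and "cinner (blinfun_apply A h) k = cinner h (blinfun_apply (op_adjoint A) k)"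
proof -
  have "\<exists>!B. B \<in> bounded_ops \<and> (\<forall>h k. cinner (A h) k = cinner h (blinfun_apply B k))"
  proof (rule ex_ex1I)
    define C where "C = (\<lambda>h k. cnj (cinner (A k) h))"
    have sC: "sesquilinear C"
      using sesquilinearD[OF sesquilinear_op[OF A]] unfolding C_def sesquilinear_def by simp
    have bC: "cmod (C h h) \<le> 4 * norm A * (norm h)\<^sup>2" for h
      unfolding C_def by (simp add: norm_cinner_op_le)
    obtain B where B: "B \<in> bounded_ops" "\<And>h k. cinner (blinfun_apply B h) k = C h k"
      using op_of_form[OF sC bC] by metis
    have "cinner (A h) k = cinner h (blinfun_apply B k)" for h k
      using cinner_commute[of h "blinfun_apply B k"] B(2)[of k h] by (simp add: C_def)
    with B(1) show "\<exists>B. B \<in> bounded_ops \<and> (\<forall>h k. cinner (A h) k = cinner h (blinfun_apply B k))"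
      by blast
  next
    fix B B' :: "'h \<Rightarrow>\<^sub>L 'h"
    assume *: "B \<in> bounded_ops \<and> (\<forall>h k. cinner (A h) k = cinner h (blinfun_apply B k))"
      and **: "B' \<in> bounded_ops \<and> (\<forall>h k. cinner (A h) k = cinner h (blinfun_apply B' k))"
    show "B = B'"
    proof (rule op_ext)
      fix h k
      have "cinner k (blinfun_apply B h) = cinner k (blinfun_apply B' h)"
        using conjunct2[OF *] conjunct2[OF **] by metis
      then show "cinner (blinfun_apply B h) k = cinner (blinfun_apply B' h) k"
        using cinner_commute[of "blinfun_apply B h" k] cinner_commute[of "blinfun_apply B' h" k]
        by simp
    qed
  qed
  from theI'[OF this, folded op_adjoint_def] show "op_adjoint A \<in> bounded_ops"
    "cinner (A h) k = cinner h (blinfun_apply (op_adjoint A) k)"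
    by blast+
qed

lemma op_Re:
  assumes A: "A \<in> bounded_ops"
  shows "op_Re A \<in> bounded_ops"
    and "cinner (blinfun_apply (op_Re A) h) h = complex_of_real (Re (cinner (blinfun_apply A h) h))"
proof -
  show "op_Re A \<in> bounded_ops"
    by (simp add: op_Re_def A bounded_ops_add bounded_ops_scaleC op_adjoint(1))
  have "cinner (blinfun_apply (op_adjoint A) h) h = cnj (cinner (A h) h)"
    by (subst cinner_commute) (simp add: op_adjoint(2)[OF A])
  then show "cinner (blinfun_apply (op_Re A) h) h = complex_of_real (Re (cinner (A h) h))"
    by (simp add: op_Re_def scaleC_blinfun_apply blinfun.add_left cinner_simps complex_eq_iff)
qed

lemma op_Im:
  assumes A: "A \<in> bounded_ops"
  shows "op_Im A \<in> bounded_ops"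
    and "cinner (blinfun_apply (op_Im A) h) h = complex_of_real (Im (cinner (blinfun_apply A h) h))"
proof -
  show "op_Im A \<in> bounded_ops"
    by (simp add: op_Im_def A bounded_ops_diff bounded_ops_scaleC op_adjoint(1))
  have "cinner (blinfun_apply (op_adjoint A) h) h = cnj (cinner (A h) h)"
    by (subst cinner_commute) (simp add: op_adjoint(2)[OF A])
  then show "cinner (blinfun_apply (op_Im A) h) h = complex_of_real (Im (cinner (A h) h))"
    by (simp add: op_Im_def scaleC_blinfun_apply blinfun.diff_left cinner_simps complex_eq_iff)
qed

lemma op_nonneg_iff:
  "op_nonneg A \<longleftrightarrow> A \<in> bounded_ops \<and>
     (\<forall>h. cinner (blinfun_apply A h) h = complex_of_real (Re (cinner (blinfun_apply A h) h)) \<and>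
        0 \<le> Re (cinner (blinfun_apply A h) h))"
  by (auto simp: op_nonneg_def complex_is_Real_iff complex_eq_iff)

lemma op_nonneg_op_Re_iff:
  "A \<in> bounded_ops \<Longrightarrow> op_nonneg (op_Re A) \<longleftrightarrow> (\<forall>h. 0 \<le> Re (cinner (blinfun_apply A h) h))"
  by (simp add: op_nonneg_def op_Re)

section \<open>Signed and complex measures\<close>

text \<open>The relation passes directly to simple functions and by dominated convergence to bounded
  measurable ones. Stating it as a vanishing sum allows complex coefficients while all measures stay
  positive; Jordan parts, polarization and sums of representing measures are all treated this
  way.\<close>

lemma integral_linear_relation:
  fixes f :: "'a \<Rightarrow> complex" and c :: "'i \<Rightarrow> complex"
  assumes fin: "\<And>i. i \<in> I \<Longrightarrow> finite_measure (\<nu> i)"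
    and sets: "\<And>i. i \<in> I \<Longrightarrow> sets (\<nu> i) = sets N"
    and f: "f \<in> borel_measurable N" "\<And>x. x \<in> space N \<Longrightarrow> norm (f x) \<le> K"
    and zero: "\<And>A. A \<in> sets N \<Longrightarrow> (\<Sum>i\<in>I. c i * measure (\<nu> i) A) = 0"
  shows "(\<Sum>i\<in>I. c i * (\<integral>x. f x \<partial>\<nu> i)) = 0"
proof -
  have space: "space (\<nu> i) = space N" if "i \<in> I" for i
    using sets[OF that] by (rule sets_eq_imp_space_eq)
  \<comment> \<open>The approximants satisfy |s n x| \<le> 2 |f x|, hence the dominating constant
    \<open>2 * K\<close> below.\<close>
  obtain s where s: "\<And>n. simple_function N (s n)"
    and lim: "\<And>x. x \<in> space N \<Longrightarrow> (\<lambda>n. s n x) \<longlonglongrightarrow> f x"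
    and bd: "\<And>n x. x \<in> space N \<Longrightarrow> norm (s n x) \<le> 2 * norm (f x)"
    using borel_measurable_implies_sequence_metric[OF f(1), of 0] by (simp add: dist_norm) metis
  have sf: "simple_function (\<nu> i) (s n)" if "i \<in> I" for i n
    using s[of n] by (simp add: simple_function_def sets[OF that] space[OF that])
  have int_s: "(\<integral>x. s n x \<partial>\<nu> i) =
      (\<Sum>y\<in>s n ` space N. measure (\<nu> i) {x\<in>space N. s n x = y} *\<^sub>R y)" if i: "i \<in> I" for i n
  proof -
    interpret finite_measure "\<nu> i" by (rule fin[OF i])
    have "Bochner_Integration.simple_bochner_integrable (\<nu> i) (s n)"
      by (rule simple_bochner_integrable.intros[OF sf[OF i]]) simp
    from simple_bochner_integrable_eq_integral[OF this] show ?thesis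
      by (simp add: simple_bochner_integral_def space[OF i])
  qed
  have "(\<Sum>i\<in>I. c i * (\<integral>x. s n x \<partial>\<nu> i)) = 0" for n
  proof -
    have "(\<Sum>i\<in>I. c i * (\<integral>x. s n x \<partial>\<nu> i)) =
        (\<Sum>i\<in>I. \<Sum>y\<in>s n ` space N. y * (c i * measure (\<nu> i) {x\<in>space N. s n x = y}))"
      by (intro sum.cong refl)
        (simp add: int_s sum_distrib_left scaleR_conv_of_real mult_ac)
    also have "\<dots> = (\<Sum>y\<in>s n ` space N. y * (\<Sum>i\<in>I. c i * measure (\<nu> i) {x\<in>space N. s n x = y}))"
      by (subst sum.swap) (simp add: sum_distrib_left)
    also have "\<dots> = 0"
    proof (rule sum.neutral, rule ballI)
      fix y
      have "s n -` {y} \<inter> space N = {x\<in>space N. s n x = y}" by blast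
      then have "{x\<in>space N. s n x = y} \<in> sets N"
        using simple_functionD(2)[OF s[of n], of "{y}"] by simp
      from zero[OF this] show "y * (\<Sum>i\<in>I. c i * measure (\<nu> i) {x\<in>space N. s n x = y}) = 0" by simp
    qed
    finally show ?thesis .
  qed
  moreover have "(\<lambda>n. \<Sum>i\<in>I. c i * (\<integral>x. s n x \<partial>\<nu> i)) \<longlonglongrightarrow> (\<Sum>i\<in>I. c i * (\<integral>x. f x \<partial>\<nu> i))"
  proof (intro tendsto_sum tendsto_mult tendsto_const)
    fix i assume i: "i \<in> I"
    interpret finite_measure "\<nu> i" by (rule fin[OF i])
    show "(\<lambda>n. \<integral>x. s n x \<partial>\<nu> i) \<longlonglongrightarrow> (\<integral>x. f x \<partial>\<nu> i)"
    proof (rule integral_dominated_convergence[where w = "\<lambda>_. 2 * K"])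
      show "f \<in> borel_measurable (\<nu> i)"
        using f(1) measurable_cong_sets[OF sets[OF i] refl] by blast
      show "s n \<in> borel_measurable (\<nu> i)" for n
        by (rule borel_measurable_simple_function[OF sf[OF i]])
      show "AE x in \<nu> i. norm (s n x) \<le> 2 * K" for n
        by (rule AE_I2) (use bd f(2) in \<open>force simp: space[OF i] intro: order_trans\<close>)
    qed (auto simp: lim space[OF i])
  qed
  ultimately show ?thesis by (simp add: LIMSEQ_const_iff)
qed

section \<open>Finite measures and the Jordan decomposition\<close>

lemma space_borel_on [simp]: "space (borel_on T) = T"
  by (simp add: space_restrict_space)

text \<open>\<open>measure_of\<close> yields the zero measure unless its set function is a measure,
  so positivity and additivity are verified once here. Additivity is asked for as a convergent real
  series because complex measures provide it in that form.\<close>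

lemma finite_measure_of:
  fixes T :: "'x :: topological_space set" and m :: "'x set \<Rightarrow> real"
  defines "S \<equiv> sets (borel_on T)"
  assumes nonneg: "\<And>A. A \<in> S \<Longrightarrow> 0 \<le> m A"
    and sums: "\<And>A :: nat \<Rightarrow> 'x set. range A \<subseteq> S \<Longrightarrow> disjoint_family A \<Longrightarrow>
      (\<lambda>n. m (A n)) sums m (\<Union>n. A n)"
    and eq: "\<And>A. A \<in> S \<Longrightarrow> \<mu> A = ennreal (m A)"
  shows "sets (measure_of T S \<mu>) = S" and "finite_measure (measure_of T S \<mu>)"
    and "\<And>A. A \<in> S \<Longrightarrow> measure (measure_of T S \<mu>) A = m A"
proof -
  have sa: "sigma_algebra T S"
    using sets.sigma_algebra_axioms[of "borel_on T"] by (simp add: S_def)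
  interpret sigma_algebra T S by fact
  show sets: "sets (measure_of T S \<mu>) = S"
    by (simp add: sets_measure_of_eq space_closed)
  \<comment> \<open>Empty sets form a disjoint family, and a constant series converges only if its
    terms vanish.\<close>
  have "(\<lambda>n::nat. m {}) sums m {}" using sums[of "\<lambda>_. {}"] by (simp add: disjoint_family_on_def)
  then have "m {} = 0" using summable_const_iff sums_summable by blast
  then have pos: "positive S \<mu>" by (simp add: positive_def eq)
  have ca: "countably_additive S \<mu>"
  proof (rule countably_additiveI)
    fix A :: "nat \<Rightarrow> 'x set"
    assume A: "range A \<subseteq> S" "disjoint_family A" "(\<Union>i. A i) \<in> S"
    then have "(\<Sum>i. ennreal (m (A i))) = ennreal (m (\<Union>i. A i))"
      by (intro suminf_ennreal_eq nonneg sums) auto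
    then show "(\<Sum>i. \<mu> (A i)) = \<mu> (\<Union>i. A i)"
      using A by (simp add: eq image_subset_iff)
  qed
  have em: "emeasure (measure_of T S \<mu>) A = ennreal (m A)" if "A \<in> S" for A
    using emeasure_measure_of_sigma[OF sa pos ca that] by (simp add: eq[OF that])
  then show "measure (measure_of T S \<mu>) A = m A" if "A \<in> S" for A
    using that nonneg by (simp add: measure_def)
  have "space (measure_of T S \<mu>) = T" by (simp add: space_measure_of_conv)
  then show "finite_measure (measure_of T S \<mu>)"
    by (intro finite_measureI) (simp add: em top)
qed

text \<open>Inside the Hahn set \<open>Y\<close> the signed measure is non-negative, outside it
  non-positive. Passing from B to \<open>B \<inter> Y\<close> and then enlarging to
  \<open>A \<inter> Y\<close> never decreases \<sigma>, so the supremum defining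
  \<open>pos_part\<close> is attained at \<open>A \<inter> Y\<close>.\<close>

lemma pos_part_hahn:
  assumes fin: "finite_measure \<nu>1" "finite_measure \<nu>2"
    and sets: "sets \<nu>1 = sets (borel_on T)" "sets \<nu>2 = sets (borel_on T)"
    and \<sigma>: "\<And>A. A \<in> sets (borel_on T) \<Longrightarrow> \<sigma> A = measure \<nu>1 A - measure \<nu>2 A"
    and Y: "Y \<in> sets (borel_on T)"
      "\<And>X. X \<in> sets (borel_on T) \<Longrightarrow> X \<subseteq> Y \<Longrightarrow> measure \<nu>2 X \<le> measure \<nu>1 X"
      "\<And>X. X \<in> sets (borel_on T) \<Longrightarrow> X \<inter> Y = {} \<Longrightarrow> measure \<nu>1 X \<le> measure \<nu>2 X"
  shows "sets (pos_part T \<sigma>) = sets (borel_on T)" and "finite_measure (pos_part T \<sigma>)"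
    and "\<And>A. A \<in> sets (borel_on T) \<Longrightarrow> measure (pos_part T \<sigma>) A = \<sigma> (A \<inter> Y)"
proof -
  interpret \<nu>1: finite_measure \<nu>1 by fact
  interpret \<nu>2: finite_measure \<nu>2 by fact
  have add: "\<sigma> B = \<sigma> (B \<inter> C) + \<sigma> (B - C)"
    if "B \<in> sets (borel_on T)" "C \<in> sets (borel_on T)" for B C
  proof -
    have "B = (B \<inter> C) \<union> (B - C)" by blast
    then have "measure \<nu>1 B = measure \<nu>1 (B \<inter> C) + measure \<nu>1 (B - C)"
      "measure \<nu>2 B = measure \<nu>2 (B \<inter> C) + measure \<nu>2 (B - C)"
      using \<nu>1.finite_measure_Union[of "B \<inter> C" "B - C"]
        \<nu>2.finite_measure_Union[of "B \<inter> C" "B - C"] that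
      by (simp_all add: sets Int_Diff_disjoint)
    then show ?thesis using that by (simp add: \<sigma> sets.Int sets.Diff)
  qed
  have eq: "(SUP B \<in> {B \<in> sets (borel_on T). B \<subseteq> A}. ennreal (\<sigma> B)) = ennreal (\<sigma> (A \<inter> Y))"
    if A: "A \<in> sets (borel_on T)" for A
  proof (rule antisym[OF SUP_least])
    fix B assume "B \<in> {B \<in> sets (borel_on T). B \<subseteq> A}"
    then have B: "B \<in> sets (borel_on T)" "B \<subseteq> A" by auto
    have "\<sigma> B = \<sigma> (B \<inter> Y) + \<sigma> (B - Y)" by (rule add[OF B(1) Y(1)])
    moreover have "\<sigma> (B - Y) \<le> 0" using B Y(1) Y(3)[of "B - Y"] by (simp add: \<sigma> sets.Diff Diff_Int_distrib2)
    moreover have "A \<inter> Y \<inter> B = B \<inter> Y" using B(2) by blast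
    then have "\<sigma> (A \<inter> Y) = \<sigma> (B \<inter> Y) + \<sigma> (A \<inter> Y - B)"
      using add[of "A \<inter> Y" B] A B Y(1) by (simp add: sets.Int)
    moreover have "0 \<le> \<sigma> (A \<inter> Y - B)"
      using A B Y(1) Y(2)[of "A \<inter> Y - B"] by (simp add: \<sigma> sets.Diff sets.Int subset_iff)
    ultimately show "ennreal (\<sigma> B) \<le> ennreal (\<sigma> (A \<inter> Y))" by (intro ennreal_leI) linarith
  next
    show "ennreal (\<sigma> (A \<inter> Y)) \<le> (SUP B \<in> {B \<in> sets (borel_on T). B \<subseteq> A}. ennreal (\<sigma> B))"
      by (rule SUP_upper) (use A Y(1) in auto)
  qed
  have nonneg: "0 \<le> \<sigma> (A \<inter> Y)" if "A \<in> sets (borel_on T)" for A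
    using that Y(1) Y(2)[of "A \<inter> Y"] by (simp add: \<sigma> sets.Int)
  have sums: "(\<lambda>n. \<sigma> (A n \<inter> Y)) sums \<sigma> ((\<Union>n. A n) \<inter> Y)"
    if A: "range A \<subseteq> sets (borel_on T)" "disjoint_family A" for A :: "nat \<Rightarrow> _"
  proof -
    have r: "range (\<lambda>n. A n \<inter> Y) \<subseteq> sets (borel_on T)" using A Y(1) by (auto intro!: sets.Int)
    have d: "disjoint_family (\<lambda>n. A n \<inter> Y)" using A(2) by (auto simp: disjoint_family_on_def)
    have U: "(\<Union>n. A n) \<inter> Y = (\<Union>n. A n \<inter> Y)" by blast
    have "(\<lambda>n. measure \<nu>1 (A n \<inter> Y) - measure \<nu>2 (A n \<inter> Y)) sums
        (measure \<nu>1 (\<Union>n. A n \<inter> Y) - measure \<nu>2 (\<Union>n. A n \<inter> Y))"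
      using r d by (intro sums_diff \<nu>1.finite_measure_UNION \<nu>2.finite_measure_UNION) (simp_all add: sets)
    moreover have "(\<Union>n. A n \<inter> Y) \<in> sets (borel_on T)" using r by (intro sets.countable_UN) auto
    ultimately show ?thesis using r unfolding U by (simp add: \<sigma> image_subset_iff)
  qed
  show "sets (pos_part T \<sigma>) = sets (borel_on T)" "finite_measure (pos_part T \<sigma>)"
    unfolding pos_part_def
    by (rule finite_measure_of[where m = "\<lambda>A. \<sigma> (A \<inter> Y)"]; fact nonneg sums eq)+
  show "measure (pos_part T \<sigma>) A = \<sigma> (A \<inter> Y)" if "A \<in> sets (borel_on T)" for A
    unfolding pos_part_def
    by (rule finite_measure_of(3)[where m = "\<lambda>A. \<sigma> (A \<inter> Y)"]; fact nonneg sums eq that)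
qed

text \<open>The pair \<open>\<nu>1\<close>, \<open>\<nu>2\<close> need not be the Jordan
  decomposition: the positive part plus \<open>\<nu>2\<close> equals the negative part plus
  \<open>\<nu>1\<close>, and integrals respect this. Any convenient decomposition thus computes the
  integral.\<close>

lemma signed_integral_eq:
  fixes g :: "'x :: topological_space \<Rightarrow> complex"
  assumes fin: "finite_measure \<nu>1" "finite_measure \<nu>2"
    and sets: "sets \<nu>1 = sets (borel_on T)" "sets \<nu>2 = sets (borel_on T)"
    and \<sigma>: "\<And>A. A \<in> sets (borel_on T) \<Longrightarrow> \<sigma> A = measure \<nu>1 A - measure \<nu>2 A"
    and g: "g \<in> borel_measurable (borel_on T)" "\<And>x. x \<in> T \<Longrightarrow> norm (g x) \<le> K"
  shows "signed_integral T \<sigma> g = (\<integral>x. g x \<partial>\<nu>1) - (\<integral>x. g x \<partial>\<nu>2)"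
proof -
  interpret \<nu>1: finite_measure \<nu>1 by fact
  interpret \<nu>2: finite_measure \<nu>2 by fact
  obtain Y where Y: "Y \<in> sets (borel_on T)"
    "\<And>X. X \<in> sets (borel_on T) \<Longrightarrow> X \<subseteq> Y \<Longrightarrow> measure \<nu>2 X \<le> measure \<nu>1 X"
    "\<And>X. X \<in> sets (borel_on T) \<Longrightarrow> X \<inter> Y = {} \<Longrightarrow> measure \<nu>1 X \<le> measure \<nu>2 X"
    using finite_unsigned_Hahn_decomposition[OF fin] sets
    by (auto simp: \<nu>1.emeasure_eq_measure \<nu>2.emeasure_eq_measure)
  have P: "sets (pos_part T \<sigma>) = sets (borel_on T)" "finite_measure (pos_part T \<sigma>)"
    by (rule pos_part_hahn[OF fin sets _ Y(1)]; fact \<sigma> Y)+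
  have P_eq: "measure (pos_part T \<sigma>) A = \<sigma> (A \<inter> Y)" if "A \<in> sets (borel_on T)" for A
    by (rule pos_part_hahn(3)[OF fin sets _ Y(1)]; fact \<sigma> Y that)
  have Y': "T - Y \<in> sets (borel_on T)" using sets.compl_sets[OF Y(1)] by simp
  have m: "- \<sigma> A = measure \<nu>2 A - measure \<nu>1 A" if "A \<in> sets (borel_on T)" for A
    using \<sigma>[OF that] by simp
  have sub: "X \<subseteq> T" if "X \<in> sets (borel_on T)" for X using sets.sets_into_space[OF that] by simp
  \<comment> \<open>For -\<sigma> the two measures exchange their roles, and the complement of
    \<open>Y\<close> is the Hahn set.\<close>
  have N: "sets (pos_part T (\<lambda>A. - \<sigma> A)) = sets (borel_on T)"
    "finite_measure (pos_part T (\<lambda>A. - \<sigma> A))"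
    "\<And>A. A \<in> sets (borel_on T) \<Longrightarrow> measure (pos_part T (\<lambda>A. - \<sigma> A)) A = - \<sigma> (A \<inter> (T - Y))"
    using sub by (intro pos_part_hahn[OF fin(2,1) sets(2,1) m Y'] Y(2,3); blast)+
  define F where "F n = [pos_part T \<sigma>, pos_part T (\<lambda>A. - \<sigma> A), \<nu>2, \<nu>1] ! n" for n
  define c where "c n = [1, -1, 1, -1 :: complex] ! n" for n
  have F: "F 0 = pos_part T \<sigma>" "F 1 = pos_part T (\<lambda>A. - \<sigma> A)" "F 2 = \<nu>2" "F 3 = \<nu>1"
    "c 0 = 1" "c 1 = -1" "c 2 = 1" "c 3 = -1" by (simp_all add: F_def c_def)
  have cases: "n = 0 \<or> n = 1 \<or> n = 2 \<or> n = 3" if "n < 4" for n :: nat using that by auto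
  have "(\<Sum>n<(4::nat). c n * (\<integral>x. g x \<partial>F n)) = 0"
  proof (rule integral_linear_relation[where N = "borel_on T" and K = K])
    fix A assume A: "A \<in> sets (borel_on T)"
    have "measure \<nu>1 A = measure \<nu>1 (A \<inter> Y) + measure \<nu>1 (A - Y)"
      "measure \<nu>2 A = measure \<nu>2 (A \<inter> Y) + measure \<nu>2 (A - Y)"
      using \<nu>1.finite_measure_Union[of "A \<inter> Y" "A - Y"]
        \<nu>2.finite_measure_Union[of "A \<inter> Y" "A - Y"] A Y(1)
      by (simp_all add: sets Int_Diff_disjoint Int_Diff_Un)
    moreover have "A \<inter> (T - Y) = A - Y" using sub[OF A] by blast
    ultimately have "measure (pos_part T \<sigma>) A - measure (pos_part T (\<lambda>A. - \<sigma> A)) A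
        + measure \<nu>2 A - measure \<nu>1 A = 0"
      using A Y(1) by (simp add: P_eq N(3) \<sigma> sets.Int sets.Diff)
    then show "(\<Sum>n<4. c n * measure (F n) A) = 0"
      by (simp add: sum_lessThan_4 F complex_eq_iff del: One_nat_def)
  next
    fix n :: nat assume "n \<in> {..<4}"
    then show "finite_measure (F n)" "sets (F n) = sets (borel_on T)"
      using cases[of n] P(1,2) N(1,2) fin sets F(1-4) by (metis lessThan_iff)+
  qed (use g in auto)
  then show ?thesis
    by (simp add: signed_integral_def sum_lessThan_4 F algebra_simps del: One_nat_def)
qed

text \<open>The weights are 1, i, -1, -i: even indices make up the real part of \<mu> and odd ones
  the imaginary part, each as a difference of two positive measures. Polarization delivers matrix
  measures in exactly this shape.\<close>

lemma complex_integral_eq: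
  fixes g :: "'x :: topological_space \<Rightarrow> complex" and \<nu> :: "nat \<Rightarrow> 'x measure"
  assumes fin: "\<And>n. finite_measure (\<nu> n)"
    and sets: "\<And>n. sets (\<nu> n) = sets (borel_on T)"
    and \<mu>: "\<And>A. A \<in> sets (borel_on T) \<Longrightarrow> \<mu> A = (\<Sum>n<4. \<i> ^ n * measure (\<nu> n) A)"
    and g: "g \<in> borel_measurable (borel_on T)" "\<And>x. x \<in> T \<Longrightarrow> norm (g x) \<le> K"
  shows "complex_integral T \<mu> g = (\<Sum>n<4. \<i> ^ n * (\<integral>x. g x \<partial>\<nu> n))"
proof -
  have i3: "\<i> ^ 3 = - \<i>" by (simp add: power3_eq_cube)
  have "signed_integral T (\<lambda>B. Re (\<mu> B)) g = (\<integral>x. g x \<partial>\<nu> 0) - (\<integral>x. g x \<partial>\<nu> 2)"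
    by (rule signed_integral_eq[OF fin fin sets sets _ g]) (simp_all add: \<mu> sum_lessThan_4 i3)
  moreover have "signed_integral T (\<lambda>B. Im (\<mu> B)) g = (\<integral>x. g x \<partial>\<nu> 1) - (\<integral>x. g x \<partial>\<nu> 3)"
    by (rule signed_integral_eq[OF fin fin sets sets _ g]) (simp_all add: \<mu> sum_lessThan_4 i3)
  ultimately show ?thesis
    by (simp add: complex_integral_def sum_lessThan_4 i3 right_diff_distrib del: One_nat_def)
qed

lemma complex_integral_of_measure:
  fixes g :: "'x :: topological_space \<Rightarrow> complex"
  assumes fin: "finite_measure \<nu>" and sets: "sets \<nu> = sets (borel_on T)"
    and \<mu>: "\<And>A. A \<in> sets (borel_on T) \<Longrightarrow> \<mu> A = complex_of_real (measure \<nu> A)"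
    and g: "g \<in> borel_measurable (borel_on T)" "\<And>x. x \<in> T \<Longrightarrow> norm (g x) \<le> K"
  shows "complex_integral T \<mu> g = (\<integral>x. g x \<partial>\<nu>)"
proof -
  \<comment> \<open>The real part is written as \<nu> minus the null measure, the zero imaginary
    part as \<nu> minus \<nu>.\<close>
  have 0: "finite_measure (null_measure \<nu>)" by (intro finite_measureI) simp
  have "signed_integral T (\<lambda>B. Re (\<mu> B)) g = (\<integral>x. g x \<partial>\<nu>) - (\<integral>x. g x \<partial>null_measure \<nu>)"
    by (rule signed_integral_eq[OF fin 0 sets _ _ g]) (simp_all add: \<mu> sets measure_def)
  moreover have "signed_integral T (\<lambda>B. Im (\<mu> B)) g = (\<integral>x. g x \<partial>\<nu>) - (\<integral>x. g x \<partial>\<nu>)"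
    by (rule signed_integral_eq[OF fin fin sets sets _ g]) (simp_all add: \<mu>)
  ultimately show ?thesis by (simp add: complex_integral_def)
qed

section \<open>Total variation and regularity\<close>

lemma total_variation_le_emeasure:
  assumes fin: "finite_measure \<nu>" and sets: "sets \<nu> = sets (borel_on T)"
    and bd: "\<And>A. A \<in> sets (borel_on T) \<Longrightarrow> cmod (\<mu> A) \<le> measure \<nu> A"
  shows "total_variation T \<mu> \<Delta> \<le> emeasure \<nu> \<Delta>"
  unfolding total_variation_def
proof (rule SUP_least, clarify)
  fix A :: "nat \<Rightarrow> _" assume A: "range A \<subseteq> sets (borel_on T)" "disjoint_family A"
  interpret finite_measure \<nu> by fact
  have "(\<Sum>n. ennreal (cmod (\<mu> (A n)))) \<le> (\<Sum>n. emeasure \<nu> (A n))"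
    using A(1) by (intro suminf_le) (auto simp: emeasure_eq_measure intro!: ennreal_leI bd)
  also have "\<dots> = emeasure \<nu> (\<Union>n. A n)"
    using A by (intro suminf_emeasure) (simp_all add: sets)
  finally show "(\<Sum>n. ennreal (cmod (\<mu> (A n)))) \<le> emeasure \<nu> (\<Union>n. A n)" .
qed

lemma total_variation_mono:
  assumes K: "K \<in> sets (borel_on T)" and D: "\<Delta> \<in> sets (borel_on T)" and sub: "K \<subseteq> \<Delta>"
  shows "total_variation T \<mu> K \<le> total_variation T \<mu> \<Delta>"
  unfolding total_variation_def[of _ _ K]
proof (rule SUP_least, clarify)
  fix A :: "nat \<Rightarrow> _" assume A: "range A \<subseteq> sets (borel_on T)" "disjoint_family A" "K = (\<Union>n. A n)"
  \<comment> \<open>The extra piece \<open>\<Delta> - K\<close> takes index 0 and shifts the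
    partition of \<open>K\<close> by one. The result partitions \<Delta> and its sum is at least as
    large.\<close>
  define A' where "A' n = (case n of 0 \<Rightarrow> \<Delta> - K | Suc n \<Rightarrow> A n)" for n
  have "A' n \<in> sets (borel_on T)" for n
    using A(1) K D by (auto simp: A'_def split: nat.split)
  moreover have "disjoint_family A'"
    using A(2,3) by (auto simp: disjoint_family_on_def A'_def split: nat.splits)
  moreover have "(\<Union>n. A' n) = \<Delta>"
  proof -
    have "x \<in> (\<Union>n. A' n) \<longleftrightarrow> x \<in> A' 0 \<or> (\<exists>n. x \<in> A' (Suc n))" for x
      by (metis UN_iff UNIV_I not0_implies_Suc)
    then show ?thesis using A(3) sub by (auto simp: A'_def)
  qed
  ultimately have "(\<Sum>n. ennreal (cmod (\<mu> (A' n)))) \<le> total_variation T \<mu> \<Delta>"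
    unfolding total_variation_def by (intro SUP_upper) auto
  moreover have "(\<Sum>n. ennreal (cmod (\<mu> (A n)))) \<le> (\<Sum>n. ennreal (cmod (\<mu> (A' n))))"
    using sums_unique[OF sums_Suc[of "\<lambda>n. ennreal (cmod (\<mu> (A' n)))", OF summable_sums[OF summableI]]]
    by (simp add: A'_def) (metis add_increasing2 order_refl zero_le)
  ultimately show "(\<Sum>n. ennreal (cmod (\<mu> (A n)))) \<le> total_variation T \<mu> \<Delta>" by simp
qed

text \<open>Regularity needs this half of the additivity of the variation: it bounds the excess of
  \<open>U\<close> over \<Delta> by the variation of their difference. Each piece of a partition is
  cut along \<Delta>.\<close>

lemma total_variation_subadditive:
  assumes ca: "complex_borel_measure T \<mu>"
    and D: "\<Delta> \<in> sets (borel_on T)" and U: "U \<in> sets (borel_on T)" and sub: "\<Delta> \<subseteq> U"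
  shows "total_variation T \<mu> U \<le> total_variation T \<mu> \<Delta> + total_variation T \<mu> (U - \<Delta>)"
  unfolding total_variation_def[of _ _ U]
proof (rule SUP_least)
  fix A assume "A \<in> {A :: nat \<Rightarrow> _. range A \<subseteq> sets (borel_on T) \<and> disjoint_family A \<and> (\<Union>n. A n) = U}"
  then have A: "range A \<subseteq> sets (borel_on T)" "disjoint_family A" "(\<Union>n. A n) = U" by simp_all
  have An: "A n \<in> sets (borel_on T)" for n using A(1) by blast
  have add: "\<mu> B = \<mu> (B \<inter> \<Delta>) + \<mu> (B - \<Delta>)" if B: "B \<in> sets (borel_on T)" for B
  proof -
    have sums: "(\<lambda>n. \<mu> (C n)) sums \<mu> (\<Union>n. C n)"
      if "range C \<subseteq> sets (borel_on T)" "disjoint_family C" for C :: "nat \<Rightarrow> _"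
      using ca that by (auto simp: complex_borel_measure_def)
    have "(\<lambda>n::nat. \<mu> {}) sums \<mu> {}" using sums[of "\<lambda>_. {}"] by (simp add: disjoint_family_on_def)
    then have 0: "\<mu> {} = 0" using summable_const_iff sums_summable by blast
    \<comment> \<open>Additivity is available for sequences, so the two pieces are padded with empty
      sets.\<close>
    define C where "C n = (if n = 0 then B \<inter> \<Delta> else if n = 1 then B - \<Delta> else {})" for n :: nat
    have "(\<lambda>n. \<mu> (C n)) sums \<mu> (\<Union>n. C n)"
      by (rule sums) (use B D in \<open>auto simp: C_def disjoint_family_on_def\<close>)
    moreover have "(\<Union>n. C n) = B" by (auto simp: C_def split: if_splits)
    moreover have "(\<lambda>n. \<mu> (C n)) sums (\<Sum>n<2. \<mu> (C n))"
      by (rule sums_finite) (auto simp: C_def 0)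
    ultimately show ?thesis by (auto simp: C_def numeral_2_eq_2 dest: sums_unique2)
  qed
  have le: "ennreal (cmod (\<mu> (A n))) \<le> ennreal (cmod (\<mu> (A n \<inter> \<Delta>))) + ennreal (cmod (\<mu> (A n - \<Delta>)))" for n
    using norm_triangle_ineq[of "\<mu> (A n \<inter> \<Delta>)" "\<mu> (A n - \<Delta>)"] add[OF An, of n]
    by (simp add: ennreal_plus[symmetric] ennreal_leI del: ennreal_plus)
  have "(\<Sum>n. ennreal (cmod (\<mu> (A n)))) \<le>
      (\<Sum>n. ennreal (cmod (\<mu> (A n \<inter> \<Delta>))) + ennreal (cmod (\<mu> (A n - \<Delta>))))"
    by (intro suminf_le le) auto
  also have "\<dots> = (\<Sum>n. ennreal (cmod (\<mu> (A n \<inter> \<Delta>)))) + (\<Sum>n. ennreal (cmod (\<mu> (A n - \<Delta>))))"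
    by (rule suminf_add[symmetric]) (rule summableI)+
  also have "\<dots> \<le> total_variation T \<mu> \<Delta> + total_variation T \<mu> (U - \<Delta>)"
  proof (rule add_mono)
    show "(\<Sum>n. ennreal (cmod (\<mu> (A n \<inter> \<Delta>)))) \<le> total_variation T \<mu> \<Delta>"
      unfolding total_variation_def
      by (rule SUP_upper2[of "\<lambda>n. A n \<inter> \<Delta>"])
        (use A sub D in \<open>auto simp: disjoint_family_on_def\<close>)
    show "(\<Sum>n. ennreal (cmod (\<mu> (A n - \<Delta>)))) \<le> total_variation T \<mu> (U - \<Delta>)"
      unfolding total_variation_def
      by (rule SUP_upper2[of "\<lambda>n. A n - \<Delta>"])
        (use A D in \<open>auto simp: disjoint_family_on_def\<close>)
  qed
  finally show "(\<Sum>n. ennreal (cmod (\<mu> (A n)))) \<le>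
      total_variation T \<mu> \<Delta> + total_variation T \<mu> (U - \<Delta>)" .
qed

text \<open>Domination transfers regularity: the variation of a set difference is at most its
  \<nu>-measure, which can be made small because finite Borel measures on a Polish space are
  regular.\<close>

lemma regular_complex_borel_measureI:
  fixes T :: "'x :: polish_space set"
  assumes T: "closed T" and ca: "complex_borel_measure T \<mu>"
    and fin: "finite_measure \<nu>" and sets: "sets \<nu> = sets (borel_on T)"
    and bd: "\<And>A. A \<in> sets (borel_on T) \<Longrightarrow> cmod (\<mu> A) \<le> measure \<nu> A"
  shows "regular_complex_borel_measure T \<mu>"
  unfolding regular_complex_borel_measure_def
proof (intro conjI ballI ca)
  interpret finite_measure \<nu> by fact
  have space: "space \<nu> = T" using sets_eq_imp_space_eq[OF sets] by simp
  have sets_iff: "A \<in> sets (borel_on T) \<longleftrightarrow> A \<subseteq> T \<and> A \<in> sets borel" for A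
    using T by (simp add: sets_restrict_space_iff)
  have "id \<in> borel_measurable (borel_on T)" by (simp add: id_def measurable_restrict_space1)
  then have id: "id \<in> borel_measurable \<nu>"
    using measurable_cong_sets[OF sets refl] by blast
  \<comment> \<open>Pushing \<nu> forward along the identity extends it by zero outside
    \<open>T\<close>, to a measure on all Borel sets of the space, for which regularity is
    known.\<close>
  define M where "M = distr \<nu> borel id"
  have M: "emeasure M A = emeasure \<nu> (A \<inter> T)" if "A \<in> sets borel" for A
    using that id by (simp add: M_def emeasure_distr space)
  have sM: "sets M = sets borel" by (simp add: M_def)
  have fM: "emeasure M (space M) \<noteq> \<infinity>" using M[of UNIV] sets_eq_imp_space_eq[OF sM] by simp
  fix \<Delta> assume D: "\<Delta> \<in> sets (borel_on T)"
  then have D': "\<Delta> \<subseteq> T" "\<Delta> \<in> sets borel" by (simp_all add: sets_iff)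
  have MD: "emeasure M \<Delta> = emeasure \<nu> \<Delta>" using D' by (simp add: M Int_absorb2)
  note tv_le = total_variation_le_emeasure[OF fin sets bd]
  show "total_variation T \<mu> \<Delta> =
      (INF U \<in> {U. openin (top_of_set T) U \<and> \<Delta> \<subseteq> U}. total_variation T \<mu> U)"
  proof (rule antisym[OF INF_greatest])
    fix U assume "U \<in> {U. openin (top_of_set T) U \<and> \<Delta> \<subseteq> U}"
    then show "total_variation T \<mu> \<Delta> \<le> total_variation T \<mu> U"
      using T by (intro total_variation_mono D)
        (auto simp: sets_iff openin_open borel_open borel_closed)
  next
    show "(INF U \<in> {U. openin (top_of_set T) U \<and> \<Delta> \<subseteq> U}. total_variation T \<mu> U)
        \<le> total_variation T \<mu> \<Delta>"
    proof (rule ennreal_le_epsilon)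
      fix e :: real assume "0 < e"
      then have "emeasure M \<Delta> < emeasure M \<Delta> + ennreal e"
        by (simp add: MD emeasure_eq_measure ennreal_plus[symmetric] ennreal_less_iff del: ennreal_plus)
      then obtain U where U: "open U" "\<Delta> \<subseteq> U" "emeasure M U < emeasure M \<Delta> + ennreal e"
        unfolding outer_regular[OF sM fM D'(2)] by (auto simp: INF_less_iff)
      have UT: "U \<inter> T \<in> sets (borel_on T)" using U T by (simp add: sets_iff borel_open borel_closed)
      have DU: "\<Delta> \<subseteq> U \<inter> T" using U D' by blast
      have "emeasure \<nu> (U \<inter> T - \<Delta>) \<le> ennreal e"
        using U(3) M[OF borel_open[OF U(1)]] finite_measure_Diff[of "U \<inter> T" \<Delta>] UT D DU \<open>0 < e\<close>
        by (simp add: MD emeasure_eq_measure sets ennreal_plus[symmetric] ennreal_less_iff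
            del: ennreal_plus)
      then have "total_variation T \<mu> (U \<inter> T - \<Delta>) \<le> ennreal e"
        using tv_le[of "U \<inter> T - \<Delta>"] by (rule order_trans[rotated])
      with total_variation_subadditive[OF ca D UT DU]
      have "total_variation T \<mu> (U \<inter> T) \<le> total_variation T \<mu> \<Delta> + ennreal e"
        by (meson add_left_mono order_trans)
      moreover have "U \<inter> T \<in> {U. openin (top_of_set T) U \<and> \<Delta> \<subseteq> U}"
        using U DU by (auto simp: openin_open)
      ultimately show "(INF U \<in> {U. openin (top_of_set T) U \<and> \<Delta> \<subseteq> U}. total_variation T \<mu> U)
          \<le> total_variation T \<mu> \<Delta> + ennreal e"
        by (rule INF_lower2[rotated])
    qed
  qed
  have KT: "K \<in> sets (borel_on T)" if "compact K" "K \<subseteq> \<Delta>" for K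
    using that D' by (auto simp: sets_iff borel_closed compact_imp_closed)
  show "total_variation T \<mu> \<Delta> = (SUP K \<in> {K. compact K \<and> K \<subseteq> \<Delta>}. total_variation T \<mu> K)"
  proof (rule antisym[OF _ SUP_least])
    fix K assume "K \<in> {K. compact K \<and> K \<subseteq> \<Delta>}"
    then show "total_variation T \<mu> K \<le> total_variation T \<mu> \<Delta>"
      using KT by (intro total_variation_mono D) auto
  next
    show "total_variation T \<mu> \<Delta> \<le> (SUP K \<in> {K. compact K \<and> K \<subseteq> \<Delta>}. total_variation T \<mu> K)"
    proof (rule ennreal_le_epsilon)
      fix e :: real assume e: "0 < e"
      have "\<exists>K. compact K \<and> K \<subseteq> \<Delta> \<and> emeasure M \<Delta> \<le> emeasure M K + ennreal e"
      \<comment> \<open>Subtraction in \<open>ennreal\<close> is truncated, so the strict inequality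
        that produces \<open>K\<close> fails for null sets; for these the empty set serves.\<close>
      proof (cases "emeasure M \<Delta> = 0")
        case False
        then have "emeasure M \<Delta> - ennreal e < emeasure M \<Delta>"
          using e by (intro ennreal_between) (auto simp: MD emeasure_eq_measure zero_less_iff_neq_zero)
        then obtain K where "compact K" "K \<subseteq> \<Delta>" "emeasure M \<Delta> - ennreal e < emeasure M K"
          by (subst (asm) (2) inner_regular[OF sM fM D'(2)]) (auto simp: less_SUP_iff)
        then show ?thesis
          by (intro exI[of _ K]) (auto simp: ennreal_minus_le_iff add.commute dest: less_imp_le)
      qed (auto intro: exI[of _ "{}"])
      then obtain K where K: "compact K" "K \<subseteq> \<Delta>" "emeasure M \<Delta> \<le> emeasure M K + ennreal e" by blast
      have MK: "emeasure M K = emeasure \<nu> K"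
        using K D' by (simp add: M borel_closed compact_imp_closed Int_absorb2)
      have "emeasure \<nu> (\<Delta> - K) \<le> ennreal e"
        using K(3) finite_measure_Diff[of \<Delta> K] KT[OF K(1,2)] D K(2) e
        by (simp add: MD MK emeasure_eq_measure sets ennreal_plus[symmetric] del: ennreal_plus)
      then have "total_variation T \<mu> (\<Delta> - K) \<le> ennreal e"
        using tv_le[of "\<Delta> - K"] by (rule order_trans[rotated])
      with total_variation_subadditive[OF ca KT[OF K(1,2)] D K(2)]
      have "total_variation T \<mu> \<Delta> \<le> total_variation T \<mu> K + ennreal e"
        by (meson add_left_mono order_trans)
      also have "total_variation T \<mu> K \<le> (SUP K \<in> {K. compact K \<and> K \<subseteq> \<Delta>}. total_variation T \<mu> K)"
        by (rule SUP_upper) (use K in auto)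
      finally show "total_variation T \<mu> \<Delta> \<le>
          (SUP K \<in> {K. compact K \<and> K \<subseteq> \<Delta>}. total_variation T \<mu> K) + ennreal e"
        by (simp add: add_right_mono)
    qed
  qed
qed

section \<open>Non-negative operator measures\<close>

lemma nonneg_op_measureD:
  assumes "nonneg_op_measure T E" and "A \<in> sets (borel_on T)"
  shows "E A \<in> bounded_ops"
    and "0 \<le> Re (cinner (blinfun_apply (E A) h) h)"
    and "cinner (blinfun_apply (E A) h) h = complex_of_real (Re (cinner (blinfun_apply (E A) h) h))"
  using assms by (auto simp: nonneg_op_measure_def op_nonneg_iff)

lemma diagonal_measure:
  assumes E: "nonneg_op_measure T E"
  shows "sets (diagonal_measure T E h) = sets (borel_on T)"
    and "finite_measure (diagonal_measure T E h)"
    and "A \<in> sets (borel_on T) \<Longrightarrow>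
      complex_of_real (measure (diagonal_measure T E h) A) = cinner (blinfun_apply (E A) h) h"
proof -
  let ?m = "\<lambda>A. Re (cinner (blinfun_apply (E A) h) h)"
  have sums: "(\<lambda>n. ?m (A n)) sums ?m (\<Union>n. A n)"
    if "range A \<subseteq> sets (borel_on T)" "disjoint_family A" for A :: "nat \<Rightarrow> _"
  proof -
    have "complex_borel_measure T (matrix_measure E h h)"
      using E by (auto simp: nonneg_op_measure_def regular_complex_borel_measure_def)
    then have "(\<lambda>n. matrix_measure E h h (A n)) sums matrix_measure E h h (\<Union>n. A n)"
      using that unfolding complex_borel_measure_def by blast
    from sums_Re[OF this] show ?thesis by (simp add: matrix_measure_def)
  qed
  note nonneg = nonneg_op_measureD(2)[OF E]
  show "sets (diagonal_measure T E h) = sets (borel_on T)" "finite_measure (diagonal_measure T E h)"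
    unfolding diagonal_measure_def
    by (rule finite_measure_of[where m = ?m]; (fact nonneg sums | rule refl))+
  have "measure (diagonal_measure T E h) A = ?m A" if A: "A \<in> sets (borel_on T)"
    unfolding diagonal_measure_def
    by (rule finite_measure_of(3)[where m = ?m]; (fact nonneg sums A | rule refl))
  then show "complex_of_real (measure (diagonal_measure T E h) A) = cinner (blinfun_apply (E A) h) h"
    if "A \<in> sets (borel_on T)"
    using that nonneg_op_measureD(3)[OF E, of A h] by simp
qed

lemma matrix_measure_polarization:
  assumes E: "nonneg_op_measure T E" and A: "A \<in> sets (borel_on T)"
  shows "matrix_measure E h k A =
    (\<Sum>n<4. \<i> ^ n * measure (diagonal_measure T E (polar_vec h k n)) A)"
  using polarization[OF sesquilinear_op[OF nonneg_op_measureD(1)[OF E A]], of h k]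
  by (simp add: matrix_measure_def diagonal_measure(3)[OF E A])

section \<open>Integration against an operator measure\<close>

context
  fixes T :: "'x :: topological_space set"
    and E :: "'x set \<Rightarrow> 'h :: complex_hilbert_space \<Rightarrow>\<^sub>L 'h"
    and g :: "'x \<Rightarrow> complex" and K :: real
  assumes E: "nonneg_op_measure T E"
    and g: "g \<in> borel_measurable (borel_on T)" "\<And>x. x \<in> T \<Longrightarrow> norm (g x) \<le> K"
begin

lemma complex_integral_matrix_measure:
  "complex_integral T (matrix_measure E h k) g =
    (\<Sum>n<4. \<i> ^ n * (\<integral>x. g x \<partial>diagonal_measure T E (polar_vec h k n)))"
  by (rule complex_integral_eq[where K = K])
    (use g in \<open>auto simp: diagonal_measure[OF E] matrix_measure_polarization[OF E]\<close>)

lemma complex_integral_diagonal: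
  "complex_integral T (matrix_measure E h h) g = (\<integral>x. g x \<partial>diagonal_measure T E h)"
  by (rule complex_integral_of_measure[where K = K])
    (use g in \<open>auto simp: diagonal_measure[OF E] matrix_measure_def\<close>)

text \<open>The Jordan decomposition is not additive in the measure, so linearity of the integral in
  \<open>matrix_measure E h k\<close> is not immediate. Expanding each term into its four positive
  diagonal measures reduces it to a relation indexed by pairs.\<close>

lemma complex_integral_matrix_relation:
  assumes zero: "\<And>A. A \<in> sets (borel_on T) \<Longrightarrow>
      (\<Sum>j\<in>J. c j * matrix_measure E (u j) (v j) A) = 0"
  shows "(\<Sum>j\<in>J. c j * complex_integral T (matrix_measure E (u j) (v j)) g) = 0"
proof -
  have "(\<Sum>p\<in>J \<times> {..<4}. c (fst p) * \<i> ^ snd p *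
      (\<integral>x. g x \<partial>diagonal_measure T E (polar_vec (u (fst p)) (v (fst p)) (snd p)))) = 0"
  proof (rule integral_linear_relation[where N = "borel_on T" and K = K])
    fix A assume A: "A \<in> sets (borel_on T)"
    show "(\<Sum>p\<in>J \<times> {..<4}. c (fst p) * \<i> ^ snd p *
        measure (diagonal_measure T E (polar_vec (u (fst p)) (v (fst p)) (snd p))) A) = 0"
      using zero[OF A]
      by (simp add: matrix_measure_polarization[OF E A] sum_distrib_left sum.cartesian_product
          case_prod_unfold mult.assoc)
  qed (use g in \<open>auto simp: diagonal_measure[OF E]\<close>)
  then show ?thesis
    by (simp add: complex_integral_matrix_measure sum_distrib_left sum.cartesian_product
        case_prod_unfold mult.assoc)
qed

lemma sesquilinear_complex_integral:
  "sesquilinear (\<lambda>h k. complex_integral T (matrix_measure E h k) g)"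
proof -
  note B = sesquilinearD[OF sesquilinear_op[OF nonneg_op_measureD(1)[OF E]]]
  let ?J = "\<lambda>h k. complex_integral T (matrix_measure E h k) g"
  \<comment> \<open>Each axiom of a sesquilinear form is an instance of one three-term relation;
    homogeneity takes 0 as its second coefficient.\<close>
  have rel: "?J u v = c1 * ?J u1 v1 + c2 * ?J u2 v2"
    if "\<And>A. A \<in> sets (borel_on T) \<Longrightarrow> cinner (blinfun_apply (E A) u) v =
      c1 * cinner (blinfun_apply (E A) u1) v1 + c2 * cinner (blinfun_apply (E A) u2) v2"
    for u v u1 v1 u2 v2 c1 c2
    using complex_integral_matrix_relation[where J = "{..<3}" and c = "\<lambda>j. [1, - c1, - c2] ! j"
        and u = "\<lambda>j. [u, u1, u2] ! j" and v = "\<lambda>j. [v, v1, v2] ! j"] that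
    by (simp add: numeral_3_eq_3 matrix_measure_def diff_eq_eq add.commute)
  show ?thesis
    unfolding sesquilinear_def
  proof (intro conjI allI)
    fix x y z c
    show "?J (x + y) z = ?J x z + ?J y z"
      using rel[of "x + y" z 1 x z 1 y z] B(1) by simp
    show "?J x (y + z) = ?J x y + ?J x z"
      using rel[of x "y + z" 1 x y 1 x z] B(3) by simp
    show "?J (c *\<^sub>C x) z = c * ?J x z"
      using rel[of "c *\<^sub>C x" z c x z 0 x z] B(2) by simp
    show "?J x (c *\<^sub>C z) = cnj c * ?J x z"
      using rel[of x "c *\<^sub>C z" "cnj c" x z 0 x z] B(4) by simp
  qed
qed

lemma op_integral:
  shows "op_integral T E g \<in> bounded_ops"
    and "cinner (blinfun_apply (op_integral T E g) h) k = complex_integral T (matrix_measure E h k) g"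
    and "cinner (blinfun_apply (op_integral T E g) h) h = (\<integral>x. g x \<partial>diagonal_measure T E h)"
proof -
  have T: "T \<in> sets (borel_on T)" using sets.top[of "borel_on T"] by simp
  \<comment> \<open>An empty \<open>T\<close> allows a negative \<open>K\<close>, hence the absolute
    value; the factor 4 comes from \<open>norm_cinner_op_le\<close>.\<close>
  have bd: "cmod (complex_integral T (matrix_measure E h h) g) \<le> (\<bar>K\<bar> * (4 * norm (E T))) * (norm h)\<^sup>2" for h
  proof -
    interpret finite_measure "diagonal_measure T E h" by (rule diagonal_measure(2)[OF E])
    have sp: "space (diagonal_measure T E h) = T"
      using sets_eq_imp_space_eq[OF diagonal_measure(1)[OF E]] by simp
    have gK: "norm (g x) \<le> \<bar>K\<bar>" if "x \<in> T" for x using g(2)[OF that] by linarith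
    have "g \<in> borel_measurable (diagonal_measure T E h)"
      using g(1) measurable_cong_sets[OF diagonal_measure(1)[OF E] refl] by blast
    then have "integrable (diagonal_measure T E h) g"
      by (rule integrable_const_bound[rotated, where B = K]) (rule AE_I2, simp add: sp g)
    then have "cmod (\<integral>x. g x \<partial>diagonal_measure T E h) \<le> (\<integral>x. \<bar>K\<bar> \<partial>diagonal_measure T E h)"
      by (intro order_trans[OF integral_norm_bound integral_mono]) (simp_all add: sp gK)
    also have "\<dots> = \<bar>K\<bar> * measure (diagonal_measure T E h) T" by (simp add: sp)
    also have "measure (diagonal_measure T E h) T = cmod (cinner (blinfun_apply (E T) h) h)"
      by (simp add: diagonal_measure(3)[OF E T, symmetric])
    also have "\<bar>K\<bar> * cmod (cinner (blinfun_apply (E T) h) h) \<le> \<bar>K\<bar> * (4 * norm (E T) * (norm h)\<^sup>2)"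
      by (intro mult_left_mono norm_cinner_op_le) simp
    finally show ?thesis by (simp add: complex_integral_diagonal mult.assoc)
  qed
  obtain A where A: "A \<in> bounded_ops"
      "\<And>h k. cinner (blinfun_apply A h) k = complex_integral T (matrix_measure E h k) g"
    using op_of_form[OF sesquilinear_complex_integral bd] by metis
  have eq: "op_integral T E g = A"
    unfolding op_integral_def
    by (rule the_equality) (use A in \<open>auto intro!: op_ext\<close>)
  show "op_integral T E g \<in> bounded_ops"
    "cinner (blinfun_apply (op_integral T E g) h) k = complex_integral T (matrix_measure E h k) g"
    "cinner (blinfun_apply (op_integral T E g) h) h = (\<integral>x. g x \<partial>diagonal_measure T E h)"
    using A complex_integral_diagonal by (simp_all add: eq)
qed

end

text \<open>By polarization \<open>B A\<close> is the only candidate for the form of the operator at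
  A. Positive measures are monotone, so the mass of \<open>T\<close> bounds these forms uniformly in
  A.\<close>

lemma nonneg_op_measure_of_measures:
  fixes T :: "'x :: polish_space set" and \<nu> :: "'h :: complex_hilbert_space \<Rightarrow> 'x measure"
  defines "B \<equiv> \<lambda>A h k. \<Sum>n<4. \<i> ^ n * complex_of_real (measure (\<nu> (polar_vec h k n)) A)"
  assumes T: "closed T"
    and fin: "\<And>h. finite_measure (\<nu> h)" and sets: "\<And>h. sets (\<nu> h) = sets (borel_on T)"
    and sesq: "\<And>A. A \<in> sets (borel_on T) \<Longrightarrow> sesquilinear (B A)"
    and diag: "\<And>A h. A \<in> sets (borel_on T) \<Longrightarrow> B A h h = complex_of_real (measure (\<nu> h) A)"
    and bound: "\<And>h. measure (\<nu> h) T \<le> M * (norm h)\<^sup>2"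
  shows "\<exists>E. nonneg_op_measure T E \<and> (\<forall>A\<in>sets (borel_on T). \<forall>h.
    cinner (blinfun_apply (E A) h) h = complex_of_real (measure (\<nu> h) A))"
proof -
  have TT: "T \<in> sets (borel_on T)" using sets.top[of "borel_on T"] by simp
  have bd: "cmod (B A h h) \<le> M * (norm h)\<^sup>2" if A: "A \<in> sets (borel_on T)" for A h
  proof -
    have "measure (\<nu> h) A \<le> measure (\<nu> h) T"
      using finite_measure.finite_measure_mono[OF fin] sets.sets_into_space[OF A] TT
      by (simp add: sets)
    with bound[of h] show ?thesis by (simp add: diag[OF A])
  qed
  have "\<exists>F. F \<in> bounded_ops \<and> (\<forall>h k. cinner (blinfun_apply F h) k = B A h k)"
    if "A \<in> sets (borel_on T)" for A
    using op_of_form[OF sesq[OF that] bd[OF that]] by metis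
  then obtain F where F: "\<And>A. A \<in> sets (borel_on T) \<Longrightarrow> F A \<in> bounded_ops"
    "\<And>A h k. A \<in> sets (borel_on T) \<Longrightarrow> cinner (blinfun_apply (F A) h) k = B A h k"
    by metis
  define E where "E = restrict F (sets (borel_on T))"
  have E: "E A \<in> bounded_ops" "cinner (blinfun_apply (E A) h) k = B A h k"
    if "A \<in> sets (borel_on T)" for A h k
    using F that by (simp_all add: E_def)
  have ops: "op_nonneg (E A)" if A: "A \<in> sets (borel_on T)" for A
    by (simp add: op_nonneg_iff E[OF A] diag[OF A])
  have M0: "0 \<le> \<bar>M\<bar>" by simp
  \<comment> \<open>\<open>M\<close> may be negative if the Hilbert space is zero, hence
    \<open>\<bar>M\<bar>\<close>.\<close>
  have norm: "norm (E A) \<le> 4 * \<bar>M\<bar>" if A: "A \<in> sets (borel_on T)" for A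
  proof (rule norm_op_le)
    fix h k
    have "cmod (B A h h) \<le> \<bar>M\<bar> * (norm h)\<^sup>2" for h
      by (rule order_trans[OF bd[OF A]]) (intro mult_right_mono; simp)
    from sesquilinear_bounded[OF sesq[OF A] this]
    show "cmod (cinner (blinfun_apply (E A) h) k) \<le> 4 * \<bar>M\<bar> * norm h * norm k"
      by (simp add: E[OF A])
  qed simp
  have reg: "regular_complex_borel_measure T (matrix_measure E h k)" for h k
  proof -
    \<comment> \<open>Powers of i have modulus 1, so the sum of the four positive measures dominates
      the matrix measure, which inherits its regularity.\<close>
    let ?m = "\<lambda>A. \<Sum>n<4. measure (\<nu> (polar_vec h k n)) A"
    have nonneg: "0 \<le> ?m A" for A by (intro sum_nonneg) simp
    have sums: "(\<lambda>n. ?m (A n)) sums ?m (\<Union>n. A n)"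
      if "range A \<subseteq> sets (borel_on T)" "disjoint_family A" for A :: "nat \<Rightarrow> _"
      using that by (intro sums_sum finite_measure.finite_measure_UNION fin) (simp_all add: sets)
    define N where "N = measure_of T (sets (borel_on T)) (\<lambda>A. ennreal (?m A))"
    have N: "sets N = sets (borel_on T)" "finite_measure N"
      unfolding N_def by (rule finite_measure_of[where m = ?m]; (fact nonneg sums | rule refl nonneg))+
    have N_eq: "measure N A = ?m A" if A: "A \<in> sets (borel_on T)" for A
      unfolding N_def by (rule finite_measure_of(3)[where m = ?m]; (fact nonneg sums A | rule refl nonneg))
    show ?thesis
    proof (rule regular_complex_borel_measureI[OF T _ N(2,1)])
      show "complex_borel_measure T (matrix_measure E h k)"
        unfolding complex_borel_measure_def
      proof (intro allI impI)
        fix A :: "nat \<Rightarrow> _" assume A: "range A \<subseteq> sets (borel_on T)" "disjoint_family A"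
        then have U: "(\<Union>n. A n) \<in> sets (borel_on T)" "\<And>n. A n \<in> sets (borel_on T)" by auto
        have "(\<lambda>j. \<Sum>n<4. \<i> ^ n * complex_of_real (measure (\<nu> (polar_vec h k n)) (A j))) sums
            (\<Sum>n<4. \<i> ^ n * complex_of_real (measure (\<nu> (polar_vec h k n)) (\<Union>j. A j)))"
          using A by (intro sums_sum sums_mult sums_of_real finite_measure.finite_measure_UNION fin)
            (simp_all add: sets)
        then show "(\<lambda>n. matrix_measure E h k (A n)) sums matrix_measure E h k (\<Union>n. A n)"
          by (simp add: matrix_measure_def E U B_def)
      qed
    next
      fix A assume A: "A \<in> sets (borel_on T)"
      have "cmod (B A h k) \<le> ?m A"
        unfolding B_def by (rule order_trans[OF norm_sum]) (simp add: norm_mult norm_power)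
      then show "cmod (matrix_measure E h k A) \<le> measure N A"
        by (simp add: matrix_measure_def E[OF A] N_eq[OF A])
    qed
  qed
  show ?thesis
  proof (intro exI conjI)
    show "nonneg_op_measure T E"
      unfolding nonneg_op_measure_def
      using ops reg norm by (auto simp: E_def intro!: bdd_aboveI2)
  qed (simp add: E diag)
qed

section \<open>Holomorphic families of operators with non-negative real part\<close>

lemma norm_vector_scalar_mult: "norm (c *s v) = cmod c * norm (v :: complex ^ 'd)"
  by (simp add: norm_vec_def norm_mult L2_set_right_distrib)

lemma of_real_vector_scalar_mult: "complex_of_real r *s v = r *\<^sub>R (v :: complex ^ 'd)"
  by (simp add: vec_eq_iff) (simp add: scaleR_conv_of_real)

text \<open>The Cayley transform (G - s) / (G + s) with s = G 0 maps the disc into itself and fixes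
  0. The Schwarz lemma at |z| \<le> 1/2 then gives |G| \<le> 3 s, and restoring the imaginary
  constant leads to 3 Re g(0) + |Im g(0)| \<le> 4 |g(0)|.\<close>

lemma herglotz_disc_bound:
  assumes hol: "g holomorphic_on ball 0 1" and pos: "\<And>z. cmod z < 1 \<Longrightarrow> 0 \<le> Re (g z)"
    and z: "cmod z \<le> 1 / 2"
  shows "cmod (g z) \<le> 4 * cmod (g 0)"
proof (rule field_le_epsilon)
  fix e :: real assume "0 < e"
  \<comment> \<open>The shift by e / 4 makes the real part strictly positive, so G + s cannot
    vanish. It costs 3 e / 4 through 3 s and e / 4 when it is removed, e in total.\<close>
  define s where "s = Re (g 0) + e / 4"
  have s: "0 < s" using pos[of 0] \<open>0 < e\<close> by (simp add: s_def)
  define G where "G w = g w - \<i> * Im (g 0) + e / 4" for w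
  have G0: "G 0 = s" by (simp add: G_def s_def complex_eq_iff)
  have ReG: "0 < Re (G w)" if "cmod w < 1" for w
    using pos[OF that] \<open>0 < e\<close> by (simp add: G_def)
  have lt: "cmod (G w - s) < cmod (G w + s)" if "cmod w < 1" for w
  proof -
    have "(cmod (G w + s))\<^sup>2 - (cmod (G w - s))\<^sup>2 = 4 * s * Re (G w)"
      by (simp add: cmod_power2) (simp add: power2_eq_square algebra_simps)
    also have "\<dots> > 0" using ReG[OF that] s by simp
    finally show ?thesis by (simp add: power_less_imp_less_base)
  qed
  have ne: "G w + s \<noteq> 0" if "cmod w < 1" for w
    using lt[OF that] norm_ge_zero[of "G w - s"] by auto
  have "cmod ((G z - s) / (G z + s)) \<le> cmod z"
  proof (rule Schwarz_Lemma(1))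
    show "(\<lambda>z. (G z - s) / (G z + s)) holomorphic_on ball 0 1"
      using ne unfolding G_def by (intro holomorphic_intros hol) (auto simp: G_def)
    show "cmod ((G w - s) / (G w + s)) < 1" if "cmod w < 1" for w
      using lt[OF that] ne[OF that] by (simp add: norm_divide divide_less_eq)
  qed (use z in \<open>auto simp: G0\<close>)
  also have "\<dots> \<le> 1 / 2" by fact
  finally have "2 * cmod (G z - s) \<le> cmod (G z + s)"
    using ne[of z] z by (simp add: norm_divide divide_le_eq)
  moreover have "cmod (G z + s) \<le> cmod (G z - s) + 2 * s"
    using norm_triangle_ineq[of "G z - s" "2 * complex_of_real s"] s
    by (simp add: norm_mult add.commute[of "G z"])
  moreover have "cmod (G z) \<le> cmod (G z - s) + s"
    using norm_triangle_ineq[of "G z - s" "complex_of_real s"] s by simp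
  ultimately have Gz: "cmod (G z) \<le> 3 * s" by linarith
  have "g z = G z + (\<i> * Im (g 0) - e / 4)" by (simp add: G_def)
  then have "cmod (g z) \<le> cmod (G z) + cmod (\<i> * Im (g 0) - e / 4)"
    by (metis norm_triangle_ineq)
  also have "cmod (\<i> * Im (g 0) - e / 4) \<le> \<bar>Im (g 0)\<bar> + e / 4"
    using norm_triangle_ineq4[of "\<i> * Im (g 0)" "complex_of_real (e / 4)"] \<open>0 < e\<close> by (simp add: norm_mult)
  finally have "cmod (g z) \<le> 3 * s + (\<bar>Im (g 0)\<bar> + e / 4)" using Gz by linarith
  also have "\<dots> = 3 * Re (g 0) + \<bar>Im (g 0)\<bar> + e" by (simp add: s_def)
  also have "\<dots> \<le> 4 * cmod (g 0) + e"
    using complex_Re_le_cmod[of "g 0"] abs_Im_le_cmod[of "g 0"] by linarith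
  finally show "cmod (g z) \<le> 4 * cmod (g 0) + e" .
qed

text \<open>Cauchy's estimates on circles of radius 1/4 about points with |w| \<le> 1/8, which stay
  inside the disc of radius 1/2, give 4 M for the first derivative and 2 * 16 M for the second. The
  remainder keeps the full 32 M because the Taylor estimate divides by 1! and not by 2!.\<close>

lemma cauchy_taylor_bounds:
  assumes hol: "F holomorphic_on ball 0 (1 / 2)" and bd: "\<And>t. cmod t < 1 / 2 \<Longrightarrow> cmod (F t) \<le> M"
  shows "cmod (deriv F 0) \<le> 4 * M"
    and "cmod t \<le> 1 / 8 \<Longrightarrow> cmod (F t - F 0 - deriv F 0 * t) \<le> 32 * M * (cmod t)\<^sup>2"
proof -
  have cauchy: "cmod ((deriv ^^ n) F w) \<le> fact n * M / (1 / 4) ^ n" if "cmod w \<le> 1 / 8" for n w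
  proof (rule Cauchy_inequality)
    have sub: "x \<in> ball 0 (1 / 2)" if "x \<in> cball w (1 / 4)" for x
    proof -
      have "cmod x \<le> cmod w + cmod (x - w)" using norm_triangle_ineq[of w "x - w"] by simp
      then show ?thesis using that \<open>cmod w \<le> 1 / 8\<close> by (simp add: dist_norm norm_minus_commute)
    qed
    then show "F holomorphic_on ball w (1 / 4)" "continuous_on (cball w (1 / 4)) F"
      by (auto intro!: holomorphic_on_subset[OF hol] continuous_on_subset[OF holomorphic_on_imp_continuous_on[OF hol]])
    show "cmod (F x) \<le> M" if "cmod (w - x) = 1 / 4" for x
      using sub[of x] that bd[of x] by (simp add: dist_norm)
  qed simp
  show "cmod (deriv F 0) \<le> 4 * M" using cauchy[of 0 1] by simp
  assume t: "cmod t \<le> 1 / 8"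
  have "cmod ((deriv ^^ 0) F t - (\<Sum>i\<le>1. (deriv ^^ i) F 0 * (t - 0) ^ i / fact i))
      \<le> 32 * M * cmod (t - 0) ^ Suc 1 / fact 1"
  proof (rule complex_Taylor[where S = "cball 0 (1 / 8)"])
    show "((deriv ^^ i) F has_field_derivative (deriv ^^ Suc i) F x) (at x within cball 0 (1 / 8))"
      if "x \<in> cball 0 (1 / 8)" for i x
      by (rule has_field_derivative_at_within, rule has_field_derivative_higher_deriv[OF hol])
        (use that in auto)
    show "cmod ((deriv ^^ Suc 1) F x) \<le> 32 * M" if "x \<in> cball 0 (1 / 8)" for x
      using cauchy[of x 2] that by (simp add: numeral_2_eq_2 power2_eq_square)
  qed (use t in auto)
  then show "cmod (F t - F 0 - deriv F 0 * t) \<le> 32 * M * (cmod t)\<^sup>2"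
    by (simp add: diff_diff_eq power2_eq_square)
qed

text \<open>Complex-linearity makes the restriction of the derivative to a complex line a
  multiplication, which is differentiability in one complex variable.\<close>

lemma holomorphic_several_line:
  fixes \<phi> :: "complex ^ 'd \<Rightarrow> complex"
  assumes hol: "holomorphic_several \<phi> \<Omega>" and U: "open U" "\<And>t. t \<in> U \<Longrightarrow> z + t *s v \<in> \<Omega>"
  shows "(\<lambda>t. \<phi> (z + t *s v)) holomorphic_on U"
    and "(\<phi> has_derivative D) (at z) \<Longrightarrow> (\<And>c v. D (c *s v) = c * D v) \<Longrightarrow>
      deriv (\<lambda>t. \<phi> (z + t *s v)) 0 = D v"
proof -
  have bl: "bounded_linear (\<lambda>t. t *s v)"
    by (rule bounded_linear_intro[where K = "norm v"])
      (simp_all add: vec_eq_iff algebra_simps norm_vector_scalar_mult)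
  have line: "((\<lambda>t. z + t *s v) has_derivative (\<lambda>s. s *s v)) (at t)" for t
    by (auto intro!: derivative_eq_intros bounded_linear_imp_has_derivative[OF bl])
  have der: "((\<lambda>t. \<phi> (z + t *s v)) has_field_derivative D v) (at t)"
    if "(\<phi> has_derivative D) (at (z + t *s v))" "\<And>c v. D (c *s v) = c * D v" for D t
  proof -
    have "(\<lambda>s. D (s *s v)) = (*) (D v)" by (simp add: fun_eq_iff that(2))
    then show ?thesis
      using has_derivative_compose[OF line that(1)] by (simp add: has_field_derivative_def)
  qed
  show "(\<lambda>t. \<phi> (z + t *s v)) holomorphic_on U"
    using hol U der unfolding holomorphic_on_open[OF U(1)] holomorphic_several_def scaleC_complex_def
    by metis
  show "deriv (\<lambda>t. \<phi> (z + t *s v)) 0 = D v"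
    if "(\<phi> has_derivative D) (at z)" "\<And>c v. D (c *s v) = c * D v"
    using der[of D 0] that by (intro DERIV_imp_deriv) simp
qed

text \<open>Holomorphy in norm follows from uniform second-order Taylor bounds on the forms
  \<open>\<langle>f h, k\<rangle>\<close>; positivity of the real part makes these forms locally bounded by Harnack's
  inequality, so that the uniform boundedness principle is not needed.\<close>

lemma holomorphic_several_opI:
  fixes f :: "complex ^ 'd \<Rightarrow> 'h :: complex_hilbert_space \<Rightarrow>\<^sub>L 'h"
  assumes \<Omega>: "open \<Omega>" and ops: "f \<in> \<Omega> \<rightarrow> bounded_ops"
    and hol: "\<And>h. holomorphic_several (\<lambda>z. cinner (blinfun_apply (f z) h) h) \<Omega>"
    and pos: "\<And>z h. z \<in> \<Omega> \<Longrightarrow> 0 \<le> Re (cinner (blinfun_apply (f z) h) h)"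
  shows "holomorphic_several f \<Omega>"
  unfolding holomorphic_several_def
proof
  define \<psi> where "\<psi> h k w = cinner (blinfun_apply (f w) h) k" for h k w
  have sesq: "sesquilinear (\<lambda>h k. \<psi> h k w)" if "w \<in> \<Omega>" for w
    using sesquilinear_op[of "f w"] ops that by (auto simp: \<psi>_def)
  have pol: "\<psi> h k w = (\<Sum>n<4. \<i> ^ n * \<psi> (polar_vec h k n) (polar_vec h k n) w)" if "w \<in> \<Omega>" for h k w
    by (rule polarization[OF sesq[OF that]])
  have ex: "\<exists>D. (\<psi> h k has_derivative D) (at w) \<and> (\<forall>c v. D (c *s v) = c * D v)" if w: "w \<in> \<Omega>" for h k w
  proof -
    have "\<forall>h. \<exists>D. (\<psi> h h has_derivative D) (at w) \<and> (\<forall>c v. D (c *s v) = c * D v)"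
      using hol w by (simp add: holomorphic_several_def scaleC_complex_def \<psi>_def[abs_def])
    then obtain D0 where D0: "\<And>h. (\<psi> h h has_derivative D0 h) (at w)"
      "\<And>h c v. D0 h (c *s v) = c * D0 h v"
      by metis
    let ?D = "\<lambda>v. \<Sum>n<4. \<i> ^ n * D0 (polar_vec h k n) v"
    have "((\<lambda>w. \<Sum>n<4. \<i> ^ n * \<psi> (polar_vec h k n) (polar_vec h k n) w) has_derivative ?D) (at w)"
      by (intro has_derivative_sum has_derivative_mult_right D0)
    then have "(\<psi> h k has_derivative ?D) (at w)"
      by (rule has_derivative_transform_within_open[OF _ \<Omega> w]) (rule pol[symmetric])
    moreover have "?D (c *s v) = c * ?D v" for c v
      by (simp add: D0(2) sum_distrib_left mult_ac)
    ultimately show ?thesis by blast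
  qed
  have hol': "holomorphic_several (\<psi> h k) \<Omega>" for h k
    using ex by (auto simp: holomorphic_several_def scaleC_complex_def)
  fix z assume z: "z \<in> \<Omega>"
  obtain R where R: "0 < R" "ball z R \<subseteq> \<Omega>" using \<Omega> z open_contains_ball by blast
  \<comment> \<open>64 = 4 * 4 * 4: Harnack's bound, the bound of the form of f z by its norm, and
    polarization.\<close>
  define M where "M = 64 * norm (f z)"
  have M: "0 \<le> M" by (simp add: M_def)
  obtain D where D: "\<And>h k. (\<psi> h k has_derivative D h k) (at z)"
    "\<And>h k c v. D h k (c *s v) = c * D h k v"
    using ex[OF z] by metis
  \<comment> \<open>Derivatives are unique, so they inherit every linear relation among the forms
    that holds on \<Omega>.\<close>
  have D_rel: "D u v x = a * D u1 v1 x + b * D u2 v2 x"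
    if "\<And>w. w \<in> \<Omega> \<Longrightarrow> \<psi> u v w = a * \<psi> u1 v1 w + b * \<psi> u2 v2 w" for u v u1 v1 u2 v2 a b x
  proof -
    have "((\<lambda>w. a * \<psi> u1 v1 w + b * \<psi> u2 v2 w) has_derivative
        (\<lambda>x. a * D u1 v1 x + b * D u2 v2 x)) (at z)"
      by (intro has_derivative_add has_derivative_mult_right D)
    then have "(\<psi> u v has_derivative (\<lambda>x. a * D u1 v1 x + b * D u2 v2 x)) (at z)"
      by (rule has_derivative_transform_within_open[OF _ \<Omega> z]) (simp add: that)
    from has_derivative_unique[OF D(1) this] show ?thesis by (simp add: fun_eq_iff)
  qed
  have D_sesq: "sesquilinear (\<lambda>h k. D h k x)" for x
    unfolding sesquilinear_def
  proof (intro conjI allI)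
    fix u v w c
    show "D (u + v) w x = D u w x + D v w x"
      using D_rel[of "u + v" w 1 u w 1 v w] sesquilinearD(1)[OF sesq] by simp
    show "D u (v + w) x = D u v x + D u w x"
      using D_rel[of u "v + w" 1 u v 1 u w] sesquilinearD(3)[OF sesq] by simp
    show "D (c *\<^sub>C u) w x = c * D u w x"
      using D_rel[of "c *\<^sub>C u" w c u w 0 u w] sesquilinearD(2)[OF sesq] by simp
    show "D u (c *\<^sub>C w) x = cnj c * D u w x"
      using D_rel[of u "c *\<^sub>C w" "cnj c" u w 0 u w] sesquilinearD(4)[OF sesq] by simp
  qed
  have line: "z + t *s v \<in> \<Omega>" if "norm v \<le> R / 2" "cmod t < 2" for t v
  proof -
    have "cmod t * norm v < R"
    proof (cases "v = 0")
      case False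
      have "cmod t * norm v < 2 * norm v" using that False by (intro mult_strict_right_mono) auto
      with that show ?thesis by simp
    qed (use R in simp)
    then have "z + t *s v \<in> ball z R" by (simp add: dist_norm norm_vector_scalar_mult)
    with R show ?thesis by blast
  qed
  have bound: "cmod (\<psi> h k (z + t *s v)) \<le> M * norm h * norm k"
    if v: "norm v \<le> R / 2" and t: "cmod t \<le> 1 / 2" for h k t v
  proof -
    have in\<Omega>: "z + t *s v \<in> \<Omega>" using line[OF v] t by simp
    have "cmod (\<psi> h h (z + t *s v)) \<le> 16 * norm (f z) * (norm h)\<^sup>2" for h
    proof -
      have "cmod (\<psi> h h (z + t *s v)) \<le> 4 * cmod (\<psi> h h (z + 0 *s v))"
      proof (rule herglotz_disc_bound[OF _ _ t])
        show "(\<lambda>t. \<psi> h h (z + t *s v)) holomorphic_on ball 0 1"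
          by (rule holomorphic_several_line(1)[OF hol']) (use line[OF v] in auto)
        show "0 \<le> Re (\<psi> h h (z + t *s v))" if "cmod t < 1" for t
          using pos[OF line[OF v], of t h] that by (simp add: \<psi>_def)
      qed
      then show ?thesis using norm_cinner_op_le[of "f z" h] by (simp add: \<psi>_def)
    qed
    from sesquilinear_bounded[OF sesq[OF in\<Omega>] this] show ?thesis by (simp add: M_def mult_ac)
  qed
  have line_hol: "(\<lambda>t. \<psi> h k (z + t *s v)) holomorphic_on ball 0 (1 / 2)"
    if v: "norm v \<le> R / 2" for h k v
    by (rule holomorphic_several_line(1)[OF hol']) (use line[OF v] in auto)
  have line_deriv: "deriv (\<lambda>t. \<psi> h k (z + t *s v)) 0 = D h k v"
    if v: "norm v \<le> R / 2" for h k v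
    by (rule holomorphic_several_line(2)[OF hol' _ _ D, where U = "ball 0 (1 / 2)"])
      (use line[OF v] in auto)
  have D_le: "cmod (D h k v) \<le> 4 * M * norm h * norm k" if v: "norm v \<le> R / 2" for h k v
    using cauchy_taylor_bounds(1)[OF line_hol[OF v, of h k], where M = "M * norm h * norm k"] bound[OF v]
    by (simp add: line_deriv[OF v] less_imp_le mult.assoc)
  have taylor: "cmod (\<psi> h k (z + t *s v) - \<psi> h k z - D h k v * t) \<le> 32 * M * (cmod t)\<^sup>2 * norm h * norm k"
    if v: "norm v \<le> R / 2" and t: "cmod t \<le> 1 / 8" for h k v t
    using cauchy_taylor_bounds(2)[OF line_hol[OF v, of h k], where M = "M * norm h * norm k" and t = t] bound[OF v] t
    by (simp add: line_deriv[OF v] less_imp_le mult_ac)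
  \<comment> \<open>The size of an increment is moved into the complex parameter, because the bounds
    along lines are uniform over directions of norm at most R / 2.\<close>
  have scale: "\<exists>v. norm v \<le> R / 2 \<and> x = complex_of_real (2 * norm x / R) *s v" for x
  proof (cases "x = 0")
    case True
    then show ?thesis using R by (intro exI[of _ 0]) simp
  next
    case False
    then show ?thesis using R
      by (intro exI[of _ "(R / (2 * norm x)) *\<^sub>R x"]) (simp add: of_real_vector_scalar_mult del: of_real_divide of_real_mult)
  qed
  have D_bound: "cmod (D h k x) \<le> 8 * M / R * norm x * norm h * norm k" for h k x
  proof -
    obtain v where v: "norm v \<le> R / 2" "x = complex_of_real (2 * norm x / R) *s v" using scale by blast
    have "cmod (D h k x) = 2 * norm x / R * cmod (D h k v)"
      by (subst v(2), subst D(2)) (use R in \<open>simp add: norm_mult norm_divide\<close>)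
    also have "\<dots> \<le> 2 * norm x / R * (4 * M * norm h * norm k)"
      using R by (intro mult_left_mono D_le v) auto
    finally show ?thesis by (simp add: mult_ac)
  qed
  have "\<exists>A. A \<in> bounded_ops \<and> (\<forall>h k. cinner (blinfun_apply A h) k = D h k x)" for x
  proof -
    have "cmod (D h h x) \<le> (8 * M / R * norm x) * (norm h)\<^sup>2" for h
      using D_bound[of h h x] by (simp add: power2_eq_square mult.assoc)
    from op_of_form[OF D_sesq this] show ?thesis by metis
  qed
  then obtain L where L: "\<And>x. L x \<in> bounded_ops" "\<And>x h k. cinner (blinfun_apply (L x) h) k = D h k x"
    by metis
  have L_add: "L (x + y) = L x + L y" for x y
    by (rule op_ext) (simp add: L blinfun.add_left cinner_simps
        linear_add[OF bounded_linear.linear[OF has_derivative_bounded_linear[OF D(1)]]])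
  have L_scale: "L (c *s x) = c *\<^sub>C L x" for c x
    by (rule op_ext) (simp add: L scaleC_blinfun_apply cinner_simps D)
  have "bounded_linear L"
  proof (rule bounded_linear_intro[where K = "8 * M / R"])
    show "L (r *\<^sub>R x) = r *\<^sub>R L x" for r x
      using L_scale[of "complex_of_real r" x] by (simp add: of_real_vector_scalar_mult scaleC_of_real)
    show "norm (L x) \<le> norm x * (8 * M / R)" for x
      by (rule norm_op_le) (use D_bound M R in \<open>auto simp: L mult_ac\<close>)
  qed (rule L_add)
  moreover have "\<exists>d>0. \<forall>y. norm (y - z) < d \<longrightarrow> norm (f y - f z - L (y - z)) \<le> e * norm (y - z)"
    if e: "0 < e" for e
  \<comment> \<open>R / 16 keeps |t| = 2 |x| / R below 1/8. In terms of x the Taylor remainder is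
    128 M |x|^2 / R^2; the added 1 guards against M = 0.\<close>
  proof (intro exI[of _ "min (R / 16) (e * R\<^sup>2 / (128 * M + 1))"] conjI allI impI)
    show "0 < min (R / 16) (e * R\<^sup>2 / (128 * M + 1))" using e R M by simp
    fix y assume y: "norm (y - z) < min (R / 16) (e * R\<^sup>2 / (128 * M + 1))"
    define x where "x = y - z"
    obtain v where v: "norm v \<le> R / 2" "x = complex_of_real (2 * norm x / R) *s v" using scale by blast
    define t where "t = complex_of_real (2 * norm x / R)"
    have nt: "cmod t = 2 * norm x / R" using R by (simp add: t_def norm_divide norm_mult)
    have t: "cmod t \<le> 1 / 8" unfolding nt using y R by (simp add: x_def field_simps)
    have xt: "x = t *s v" "y = z + t *s v" using v(2) by (simp_all add: t_def x_def[symmetric]) (simp add: x_def)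
    have "norm (f y - f z - L x) \<le> 32 * M * (cmod t)\<^sup>2"
    proof (rule norm_op_le)
      fix h k
      have "cinner (blinfun_apply (f y - f z - L x) h) k = \<psi> h k (z + t *s v) - \<psi> h k z - D h k v * t"
        by (simp add: blinfun.diff_left cinner_simps \<psi>_def L xt(2)[symmetric])
          (simp add: xt(1) D)
      with taylor[OF v(1) t, of h k]
      show "cmod (cinner (blinfun_apply (f y - f z - L x) h) k) \<le> 32 * M * (cmod t)\<^sup>2 * norm h * norm k"
        by simp
    qed (use M in simp)
    also have "\<dots> = 128 * M / R\<^sup>2 * norm x * norm x"
      by (simp add: nt power2_eq_square)
    also have "\<dots> \<le> e * norm x"
    proof (rule mult_right_mono)
      have "128 * M * norm x \<le> (128 * M + 1) * norm x" by (simp add: mult_right_mono)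
      also have "\<dots> \<le> e * R\<^sup>2" using y M by (simp add: x_def field_simps)
      finally show "128 * M / R\<^sup>2 * norm x \<le> e" using R by (simp add: field_simps)
    qed simp
    finally show "norm (f y - f z - L (y - z)) \<le> e * norm (y - z)" by (simp add: x_def)
  qed
  ultimately show "\<exists>D. (f has_derivative D) (at z) \<and> (\<forall>c v. D (c *s v) = c *\<^sub>C D v)"
    using L_scale by (intro exI[of _ L]) (auto simp: has_derivative_at_alt)
qed

section \<open>Herglotz representations\<close>

lemma holomorphic_several_sum:
  fixes g :: "'i \<Rightarrow> complex ^ 'd \<Rightarrow> complex"
  assumes "\<And>j. j \<in> J \<Longrightarrow> holomorphic_several (g j) \<Omega>"
  shows "holomorphic_several (\<lambda>z. \<Sum>j\<in>J. b j * g j z) \<Omega>"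
  unfolding holomorphic_several_def
proof
  fix z assume "z \<in> \<Omega>"
  then have "\<forall>j\<in>J. \<exists>D. (g j has_derivative D) (at z) \<and> (\<forall>c v. D (c *s v) = c * D v)"
    using assms by (simp add: holomorphic_several_def scaleC_complex_def)
  then obtain D where D: "\<And>j. j \<in> J \<Longrightarrow> (g j has_derivative D j) (at z)"
    "\<And>j c v. j \<in> J \<Longrightarrow> D j (c *s v) = c * D j v"
    by metis
  show "\<exists>D. ((\<lambda>z. \<Sum>j\<in>J. b j * g j z) has_derivative D) (at z) \<and> (\<forall>c v. D (c *s v) = c *\<^sub>C D v)"
  proof (intro exI conjI allI)
    show "((\<lambda>z. \<Sum>j\<in>J. b j * g j z) has_derivative (\<lambda>v. \<Sum>j\<in>J. b j * D j v)) (at z)"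
      by (intro has_derivative_sum has_derivative_mult_right D)
    show "(\<Sum>j\<in>J. b j * D j (c *s v)) = c *\<^sub>C (\<Sum>j\<in>J. b j * D j v)" for c v
      by (simp add: D(2) scaleC_complex_def sum_distrib_left mult_ac)
  qed
qed

lemma holomorphic_several_cinner:
  fixes f :: "complex ^ 'd \<Rightarrow> 'h :: complex_hilbert_space \<Rightarrow>\<^sub>L 'h"
  assumes "holomorphic_several f \<Omega>"
  shows "holomorphic_several (\<lambda>z. cinner (blinfun_apply (f z) h) k) \<Omega>"
  unfolding holomorphic_several_def
proof
  fix z assume "z \<in> \<Omega>"
  then obtain D where D: "(f has_derivative D) (at z)" "\<And>c v. D (c *s v) = c *\<^sub>C D v"
    using assms by (auto simp: holomorphic_several_def)
  have "bounded_linear (\<lambda>A. cinner (blinfun_apply A h) k)"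
    by (rule bounded_linear_compose[OF bounded_linear_cinner_left blinfun.bounded_linear_left])
  from bounded_linear.has_derivative[OF this D(1)]
  show "\<exists>D. ((\<lambda>z. cinner (blinfun_apply (f z) h) k) has_derivative D) (at z) \<and>
      (\<forall>c v. D (c *s v) = c *\<^sub>C D v)"
    by (intro exI conjI) (auto simp: D(2) scaleC_blinfun_apply cinner_simps scaleC_complex_def)
qed

lemma herglotz_cinner:
  assumes "f \<in> herglotz_op \<Omega>"
  shows "(\<lambda>z. cinner (blinfun_apply (f z) h) h) \<in> herglotz \<Omega>"
  using assms
  by (auto simp: herglotz_op_def herglotz_def holomorphic_several_cinner op_nonneg_op_Re_iff Pi_iff)

lemma diagonal_measure_borel: "nonneg_op_measure T E \<Longrightarrow> diagonal_measure T E h \<in> borel_measures T"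
  by (simp add: borel_measures_def diagonal_measure)

section \<open>Consequences of the unique scalar representation\<close>

context
  fixes \<Omega> T :: "(complex ^ 'd) set"
    and z\<^sub>0 :: "complex ^ 'd"
    and H :: "complex ^ 'd \<Rightarrow> complex ^ 'd \<Rightarrow> complex"
  assumes \<Omega>: "open \<Omega>" and T: "compact T" and z\<^sub>0: "z\<^sub>0 \<in> \<Omega>"
    and cont: "\<forall>z\<in>\<Omega>. continuous_on T (H z)"
    and H1: "\<forall>\<zeta>\<in>T. H z\<^sub>0 \<zeta> = 1"
    and ex1: "\<forall>g\<in>herglotz \<Omega>. \<exists>!\<nu>. \<nu> \<in> borel_measures T \<and> herglotz_rep \<Omega> H z\<^sub>0 g \<nu>"
begin

lemma kernel_measurable: "z \<in> \<Omega> \<Longrightarrow> H z \<in> borel_measurable (borel_on T)"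
  using cont by (intro borel_measurable_continuous_on_restrict) auto

lemma kernel_bounded:
  assumes "z \<in> \<Omega>"
  obtains K where "\<And>\<zeta>. \<zeta> \<in> T \<Longrightarrow> cmod (H z \<zeta>) \<le> K"
  using compact_imp_bounded[OF compact_continuous_image[OF cont[rule_format, OF assms] T]]
  unfolding bounded_iff by auto

lemma herglotz_rep_sum:
  assumes J: "finite J" and b: "\<And>j. j \<in> J \<Longrightarrow> 0 \<le> b j"
    and g: "\<And>j. j \<in> J \<Longrightarrow> g j \<in> herglotz \<Omega>"
    and \<nu>: "\<And>j. j \<in> J \<Longrightarrow> \<nu> j \<in> borel_measures T" "\<And>j. j \<in> J \<Longrightarrow> herglotz_rep \<Omega> H z\<^sub>0 (g j) (\<nu> j)"
  shows "\<exists>N\<in>borel_measures T. herglotz_rep \<Omega> H z\<^sub>0 (\<lambda>z. \<Sum>j\<in>J. complex_of_real (b j) * g j z) N \<and>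
    (\<forall>A\<in>sets (borel_on T). measure N A = (\<Sum>j\<in>J. b j * measure (\<nu> j) A))"
proof -
  have fin: "finite_measure (\<nu> j)" and sets: "sets (\<nu> j) = sets (borel_on T)" if "j \<in> J" for j
    using \<nu>(1)[OF that] by (auto simp: borel_measures_def)
  let ?m = "\<lambda>A. \<Sum>j\<in>J. b j * measure (\<nu> j) A"
  have nonneg: "0 \<le> ?m A" for A by (intro sum_nonneg mult_nonneg_nonneg b) simp_all
  have sums: "(\<lambda>n. ?m (A n)) sums ?m (\<Union>n. A n)"
    if "range A \<subseteq> sets (borel_on T)" "disjoint_family A" for A :: "nat \<Rightarrow> _"
    using that by (intro sums_sum sums_mult finite_measure.finite_measure_UNION fin) (simp_all add: sets)
  define N where "N = measure_of T (sets (borel_on T)) (\<lambda>A. ennreal (?m A))"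
  have N: "sets N = sets (borel_on T)" "finite_measure N"
    unfolding N_def by (rule finite_measure_of[where m = ?m]; (fact nonneg sums | rule refl nonneg))+
  have N_eq: "measure N A = ?m A" if A: "A \<in> sets (borel_on T)" for A
    unfolding N_def by (rule finite_measure_of(3)[where m = ?m]; (fact nonneg sums A | rule refl nonneg))
  have int: "(\<integral>\<zeta>. H z \<zeta> \<partial>N) = (\<Sum>j\<in>J. complex_of_real (b j) * (\<integral>\<zeta>. H z \<zeta> \<partial>\<nu> j))" if z: "z \<in> \<Omega>" for z
  proof -
    obtain K where K: "\<And>\<zeta>. \<zeta> \<in> T \<Longrightarrow> cmod (H z \<zeta>) \<le> K" using kernel_bounded[OF z] by blast
    \<comment> \<open>The index \<open>None\<close> carries \<open>N\<close> with coefficient -1,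
      turning the equation for \<open>N\<close> into a vanishing relation.\<close>
    let ?I = "insert None (Some ` J)"
    let ?c = "\<lambda>i. case i of None \<Rightarrow> - 1 | Some j \<Rightarrow> complex_of_real (b j)"
    let ?N = "\<lambda>i. case i of None \<Rightarrow> N | Some j \<Rightarrow> \<nu> j"
    have sum_I: "sum F ?I = F None + (\<Sum>j\<in>J. F (Some j))" for F :: "_ \<Rightarrow> complex"
      using J by (subst sum.insert) (auto simp: sum.reindex)
    have "(\<Sum>i\<in>?I. ?c i * (\<integral>\<zeta>. H z \<zeta> \<partial>?N i)) = 0"
      by (rule integral_linear_relation[where N = "borel_on T" and K = K])
        (use K kernel_measurable[OF z] fin sets N in
          \<open>auto simp: sum_I N_eq J simp del: sum.insert split: option.split\<close>)
    then show ?thesis unfolding sum_I by simp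
  qed
  have "herglotz_rep \<Omega> H z\<^sub>0 (\<lambda>z. \<Sum>j\<in>J. complex_of_real (b j) * g j z) N"
    unfolding herglotz_rep_def
  proof
    fix z assume z: "z \<in> \<Omega>"
    have "(\<Sum>j\<in>J. complex_of_real (b j) * g j z) =
        (\<Sum>j\<in>J. complex_of_real (b j) * (\<i> * complex_of_real (Im (g j z\<^sub>0)) + (\<integral>\<zeta>. H z \<zeta> \<partial>\<nu> j)))"
      using \<nu>(2) z by (intro sum.cong refl) (auto simp: herglotz_rep_def)
    also have "\<dots> = \<i> * complex_of_real (Im (\<Sum>j\<in>J. complex_of_real (b j) * g j z\<^sub>0)) + (\<integral>\<zeta>. H z \<zeta> \<partial>N)"
      by (simp add: int[OF z] distrib_left sum.distrib sum_distrib_left mult_ac)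
    finally show "(\<Sum>j\<in>J. complex_of_real (b j) * g j z) =
      \<i> * complex_of_real (Im (\<Sum>j\<in>J. complex_of_real (b j) * g j z\<^sub>0)) + (\<integral>\<zeta>. H z \<zeta> \<partial>N)" .
  qed
  then show ?thesis using N N_eq by (intro bexI[of _ N]) (auto simp: borel_measures_def)
qed

lemma herglotz_rep_unique:
  assumes "g \<in> herglotz \<Omega>" "\<nu> \<in> borel_measures T" "\<nu>' \<in> borel_measures T"
    and "herglotz_rep \<Omega> H z\<^sub>0 g \<nu>" "herglotz_rep \<Omega> H z\<^sub>0 g \<nu>'"
  shows "\<nu> = \<nu>'"
  using ex1 assms by blast

text \<open>Signed relations are split into their positive and negative parts, as only non-negative
  combinations of Herglotz functions are covered by the uniqueness of the measure.\<close>

lemma herglotz_measure_relation: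
  fixes a :: "'i \<Rightarrow> real"
  assumes J: "finite J"
    and g: "\<And>j. j \<in> J \<Longrightarrow> g j \<in> herglotz \<Omega>"
    and \<nu>: "\<And>j. j \<in> J \<Longrightarrow> \<nu> j \<in> borel_measures T" "\<And>j. j \<in> J \<Longrightarrow> herglotz_rep \<Omega> H z\<^sub>0 (g j) (\<nu> j)"
    and zero: "\<And>z. z \<in> \<Omega> \<Longrightarrow> (\<Sum>j\<in>J. complex_of_real (a j) * g j z) = 0"
    and A: "A \<in> sets (borel_on T)"
  shows "(\<Sum>j\<in>J. a j * measure (\<nu> j) A) = 0"
proof -
  let ?g = "\<lambda>b z. \<Sum>j\<in>J. complex_of_real (b j) * g j z"
  define p where "p j = max (a j) 0" for j
  define n where "n j = max (- a j) 0" for j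
  have a: "a j = p j - n j" for j by (simp add: p_def n_def)
  have ex: "\<exists>N\<in>borel_measures T. herglotz_rep \<Omega> H z\<^sub>0 (?g b) N \<and>
      (\<forall>A\<in>sets (borel_on T). measure N A = (\<Sum>j\<in>J. b j * measure (\<nu> j) A))" if "\<And>j. 0 \<le> b j" for b
    by (rule herglotz_rep_sum[OF J]) (use that g \<nu> in auto)
  obtain P where P: "P \<in> borel_measures T" "herglotz_rep \<Omega> H z\<^sub>0 (?g p) P"
    "measure P A = (\<Sum>j\<in>J. p j * measure (\<nu> j) A)"
    using ex[of p] A by (auto simp: p_def)
  obtain N where N: "N \<in> borel_measures T" "herglotz_rep \<Omega> H z\<^sub>0 (?g n) N"
    "measure N A = (\<Sum>j\<in>J. n j * measure (\<nu> j) A)"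
    using ex[of n] A by (auto simp: n_def)
  \<comment> \<open>The two combinations agree only on \<Omega>; the base point lies there, so the
    imaginary constant carries over as well.\<close>
  have eq: "?g p z = ?g n z" if "z \<in> \<Omega>" for z
    using zero[OF that] by (simp add: a left_diff_distrib sum_subtractf)
  have "?g p \<in> herglotz \<Omega>"
    using g unfolding herglotz_def
    by (auto simp: Re_sum p_def intro!: holomorphic_several_sum sum_nonneg)
  moreover have "herglotz_rep \<Omega> H z\<^sub>0 (?g p) N"
    unfolding herglotz_rep_def
  proof
    fix z assume z: "z \<in> \<Omega>"
    show "?g p z = \<i> * complex_of_real (Im (?g p z\<^sub>0)) + (\<integral>\<zeta>. H z \<zeta> \<partial>N)"
      unfolding eq[OF z] eq[OF z\<^sub>0] using N(2) z unfolding herglotz_rep_def by blast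
  qed
  ultimately have "P = N" using herglotz_rep_unique P N by blast
  with P(3) N(3) show ?thesis by (simp add: a left_diff_distrib sum_subtractf)
qed

text \<open>Both sides of the operator equation are complex-linear, so their diagonals decide
  equality, and the diagonal of \<open>op_integral\<close> is an ordinary integral. This is the
  bridge to the scalar hypotheses.\<close>

lemma herglotz_op_rep_iff:
  fixes f :: "complex ^ 'd \<Rightarrow> 'h :: complex_hilbert_space \<Rightarrow>\<^sub>L 'h"
  assumes f: "f \<in> \<Omega> \<rightarrow> bounded_ops" and E: "nonneg_op_measure T E"
  shows "herglotz_op_rep \<Omega> T H z\<^sub>0 f E \<longleftrightarrow>
    (\<forall>h. herglotz_rep \<Omega> H z\<^sub>0 (\<lambda>z. cinner (blinfun_apply (f z) h) h) (diagonal_measure T E h))"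
proof -
  have f0: "f z\<^sub>0 \<in> bounded_ops" using f z\<^sub>0 by auto
  have "f z = \<i> *\<^sub>C op_Im (f z\<^sub>0) + op_integral T E (H z) \<longleftrightarrow>
      (\<forall>h. cinner (blinfun_apply (f z) h) h =
        \<i> * complex_of_real (Im (cinner (blinfun_apply (f z\<^sub>0) h) h)) + (\<integral>\<zeta>. H z \<zeta> \<partial>diagonal_measure T E h))"
    (is "f z = ?R \<longleftrightarrow> _") if z: "z \<in> \<Omega>" for z
  proof -
    obtain K where K: "\<And>\<zeta>. \<zeta> \<in> T \<Longrightarrow> cmod (H z \<zeta>) \<le> K" using kernel_bounded[OF z] by blast
    have I1: "op_integral T E (H z) \<in> bounded_ops"
      by (rule op_integral(1)[OF E kernel_measurable[OF z]]) (fact K)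
    have I2: "cinner (blinfun_apply (op_integral T E (H z)) h) h = (\<integral>\<zeta>. H z \<zeta> \<partial>diagonal_measure T E h)" for h
      by (rule op_integral(3)[OF E kernel_measurable[OF z]]) (fact K)
    have R: "?R \<in> bounded_ops" by (intro bounded_ops_add bounded_ops_scaleC op_Im(1) f0 I1)
    have "cinner (blinfun_apply ?R h) h = \<i> * complex_of_real (Im (cinner (blinfun_apply (f z\<^sub>0) h) h))
        + (\<integral>\<zeta>. H z \<zeta> \<partial>diagonal_measure T E h)" for h
      by (simp add: blinfun.add_left scaleC_blinfun_apply cinner_simps op_Im(2)[OF f0] I2)
    moreover have "f z \<in> bounded_ops" using f z by auto
    ultimately show ?thesis using op_ext_diag[OF _ R, of "f z"] by metis
  qed
  then show ?thesis by (auto simp: herglotz_op_rep_def herglotz_rep_def)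
qed

text \<open>The measures are chosen vector by vector, with no visible dependence on h. What connects
  them is \<open>rel\<close>: a relation valid on the diagonals of all sesquilinear forms holds for
  those of f z, hence for the measures. Quantifying over all forms lets each property of
  \<open>B A\<close> be checked by polarizing an arbitrary form.\<close>

lemma herglotz_op_rep_ex:
  fixes f :: "complex ^ 'd \<Rightarrow> 'h :: complex_hilbert_space \<Rightarrow>\<^sub>L 'h"
  assumes f: "f \<in> herglotz_op \<Omega>"
  shows "\<exists>E. nonneg_op_measure T E \<and> herglotz_op_rep \<Omega> T H z\<^sub>0 f E"
proof -
  have ops: "f \<in> \<Omega> \<rightarrow> bounded_ops" using f by (simp add: herglotz_op_def)
  define q where "q h z = cinner (blinfun_apply (f z) h) h" for h z
  have q: "q h \<in> herglotz \<Omega>" for h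
    using herglotz_cinner[OF f] by (simp add: q_def[abs_def])
  then have "\<forall>h. \<exists>\<nu>. \<nu> \<in> borel_measures T \<and> herglotz_rep \<Omega> H z\<^sub>0 (q h) \<nu>" using ex1 by blast
  then obtain \<nu> where \<nu>: "\<And>h. \<nu> h \<in> borel_measures T" "\<And>h. herglotz_rep \<Omega> H z\<^sub>0 (q h) (\<nu> h)" by metis
  have fin: "finite_measure (\<nu> h)" and sets: "sets (\<nu> h) = sets (borel_on T)" for h
    using \<nu>(1)[of h] by (auto simp: borel_measures_def)
  define B where "B = (\<lambda>A h k. \<Sum>n<4. \<i> ^ n * complex_of_real (measure (\<nu> (polar_vec h k n)) A))"
  \<comment> \<open>Applying the relation also to the adjoint form separates real and imaginary parts of \<open>c\<close>.\<close>
  have rel: "(\<Sum>j\<in>J. c j * complex_of_real (measure (\<nu> (u j)) A)) = 0"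
    if J: "finite J" and A: "A \<in> sets (borel_on T)"
      and zero: "\<And>Q :: 'h \<Rightarrow> 'h \<Rightarrow> complex. sesquilinear Q \<Longrightarrow> (\<Sum>j\<in>J. c j * Q (u j) (u j)) = 0"
    for J :: "'i set" and c u A
  proof -
    have *: "(\<Sum>j\<in>J. c j * q (u j) z) = 0" "(\<Sum>j\<in>J. cnj (c j) * q (u j) z) = 0" if "z \<in> \<Omega>" for z
    proof -
      have s: "sesquilinear (\<lambda>h k. cinner (blinfun_apply (f z) h) k)"
        using sesquilinear_op[of "f z"] ops that by auto
      from zero[OF s] show "(\<Sum>j\<in>J. c j * q (u j) z) = 0" by (simp add: q_def)
      have "sesquilinear (\<lambda>h k. cnj (cinner (blinfun_apply (f z) k) h))"
        unfolding sesquilinear_def by (simp add: sesquilinearD[OF s])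
      from arg_cong[OF zero[OF this], of cnj] show "(\<Sum>j\<in>J. cnj (c j) * q (u j) z) = 0"
        by (simp add: q_def)
    qed
    have "(\<Sum>j\<in>J. complex_of_real (Re (c j)) * q (u j) z) = 0"
      and "(\<Sum>j\<in>J. complex_of_real (Im (c j)) * q (u j) z) = 0" if "z \<in> \<Omega>" for z
    proof -
      have "(\<Sum>j\<in>J. complex_of_real (Re (c j)) * q (u j) z) =
          ((\<Sum>j\<in>J. c j * q (u j) z) + (\<Sum>j\<in>J. cnj (c j) * q (u j) z)) / 2"
        by (simp add: sum.distrib[symmetric] distrib_right[symmetric] complex_add_cnj sum_divide_distrib)
      then show "(\<Sum>j\<in>J. complex_of_real (Re (c j)) * q (u j) z) = 0" by (simp add: *[OF that])
      have "2 * \<i> * (\<Sum>j\<in>J. complex_of_real (Im (c j)) * q (u j) z) =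
          (\<Sum>j\<in>J. c j * q (u j) z) - (\<Sum>j\<in>J. cnj (c j) * q (u j) z)"
        by (simp add: sum_subtractf[symmetric] left_diff_distrib[symmetric] complex_diff_cnj
            sum_distrib_left mult_ac)
      then show "(\<Sum>j\<in>J. complex_of_real (Im (c j)) * q (u j) z) = 0" by (simp add: *[OF that])
    qed
    then have "(\<Sum>j\<in>J. Re (c j) * measure (\<nu> (u j)) A) = 0" "(\<Sum>j\<in>J. Im (c j) * measure (\<nu> (u j)) A) = 0"
      by (auto intro!: herglotz_measure_relation[OF J _ _ _ _ A, where g = "\<lambda>j. q (u j)"] q \<nu>)
    then show ?thesis by (simp add: complex_eq_iff Re_sum Im_sum)
  qed
  have diag: "B A h h = complex_of_real (measure (\<nu> h) A)" if A: "A \<in> sets (borel_on T)" for A h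
  proof -
    \<comment> \<open>Polarization at h = k, moved to one side: the fifth vector is \<open>h\<close>
      itself, with weight -1.\<close>
    let ?u = "\<lambda>n. if n < 4 then polar_vec h h n else h"
    let ?c = "\<lambda>n::nat. if n < 4 then \<i> ^ n else - 1"
    have 5: "sum F {..<5} = sum F {..<4} + F 4" for F :: "nat \<Rightarrow> complex"
      by (simp add: eval_nat_numeral)
    have "(\<Sum>n<5. ?c n * complex_of_real (measure (\<nu> (?u n)) A)) = 0"
    proof (rule rel[OF _ A])
      fix Q :: "'h \<Rightarrow> 'h \<Rightarrow> complex" assume "sesquilinear Q"
      from polarization[OF this, of h h] show "(\<Sum>n<5. ?c n * Q (?u n) (?u n)) = 0"
        by (simp add: 5)
    qed simp
    then show ?thesis by (simp add: 5 B_def)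
  qed
  have sesq: "sesquilinear (B A)" if A: "A \<in> sets (borel_on T)" for A
  proof -
    have form: "B A u v = c1 * B A u1 v1 + c2 * B A u2 v2"
      if form: "\<And>Q :: 'h \<Rightarrow> 'h \<Rightarrow> complex. sesquilinear Q \<Longrightarrow> Q u v = c1 * Q u1 v1 + c2 * Q u2 v2"
      for u v u1 v1 u2 v2 c1 c2
    proof -
      \<comment> \<open>Three terms, each polarized into four, give one relation among twelve
        diagonal values.\<close>
      let ?d = "\<lambda>j. [1, - c1, - c2] ! j"
      let ?w = "\<lambda>(j, n). polar_vec ([u, u1, u2] ! j) ([v, v1, v2] ! j) n"
      have 3: "(\<Sum>p\<in>{..<3} \<times> {..<4}. (case p of (j, n) \<Rightarrow> ?d j * \<i> ^ n) * F (?w p)) =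
          (\<Sum>n<4. \<i> ^ n * F (polar_vec u v n)) - c1 * (\<Sum>n<4. \<i> ^ n * F (polar_vec u1 v1 n))
            - c2 * (\<Sum>n<4. \<i> ^ n * F (polar_vec u2 v2 n))" for F
      proof -
        have "(\<Sum>p\<in>{..<3} \<times> {..<4}. (case p of (j, n) \<Rightarrow> ?d j * \<i> ^ n) * F (?w p)) =
            (\<Sum>j<3. ?d j * (\<Sum>n<4. \<i> ^ n * F (polar_vec ([u, u1, u2] ! j) ([v, v1, v2] ! j) n)))"
          by (simp only: sum.cartesian_product' sum_distrib_left split_conv mult.assoc)
        then show ?thesis by (simp add: numeral_3_eq_3)
      qed
      have "(\<Sum>p\<in>{..<3} \<times> {..<4}. (case p of (j, n) \<Rightarrow> ?d j * \<i> ^ n) * complex_of_real (measure (\<nu> (?w p)) A)) = 0"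
      proof (rule rel[OF _ A])
        fix Q :: "'h \<Rightarrow> 'h \<Rightarrow> complex" assume Q: "sesquilinear Q"
        have "(\<Sum>p\<in>{..<3} \<times> {..<4}. (case p of (j, n) \<Rightarrow> ?d j * \<i> ^ n) * Q (?w p) (?w p)) =
            Q u v - c1 * Q u1 v1 - c2 * Q u2 v2"
          unfolding polarization[OF Q, of u v] polarization[OF Q, of u1 v1] polarization[OF Q, of u2 v2]
          by (rule 3)
        then show "(\<Sum>p\<in>{..<3} \<times> {..<4}. (case p of (j, n) \<Rightarrow> ?d j * \<i> ^ n) * Q (?w p) (?w p)) = 0"
          using form[OF Q] by simp
      qed simp
      then show ?thesis unfolding 3[of "\<lambda>h. complex_of_real (measure (\<nu> h) A)"] B_def by (simp add: diff_eq_eq add.commute)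
    qed
    show ?thesis
      unfolding sesquilinear_def
    proof (intro conjI allI)
      fix x y z c
      show "B A (x + y) z = B A x z + B A y z"
        using form[of "x + y" z 1 x z 1 y z] by (simp add: sesquilinearD)
      show "B A x (y + z) = B A x y + B A x z"
        using form[of x "y + z" 1 x y 1 x z] by (simp add: sesquilinearD)
      show "B A (c *\<^sub>C x) z = c * B A x z"
        using form[of "c *\<^sub>C x" z c x z 0 x z] by (simp add: sesquilinearD)
      show "B A x (c *\<^sub>C z) = cnj c * B A x z"
        using form[of x "c *\<^sub>C z" "cnj c" x z 0 x z] by (simp add: sesquilinearD)
    qed
  qed
  have bound: "measure (\<nu> h) T \<le> (4 * norm (f z\<^sub>0)) * (norm h)\<^sup>2" for h
  proof -
    have sp: "space (\<nu> h) = T" using sets_eq_imp_space_eq[OF sets] by simp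
    have "q h z\<^sub>0 = \<i> * complex_of_real (Im (q h z\<^sub>0)) + (\<integral>\<zeta>. H z\<^sub>0 \<zeta> \<partial>\<nu> h)"
      using \<nu>(2)[of h] z\<^sub>0 unfolding herglotz_rep_def by blast
    also have "(\<integral>\<zeta>. H z\<^sub>0 \<zeta> \<partial>\<nu> h) = (\<integral>\<zeta>. 1 \<partial>\<nu> h)"
      using H1 by (intro Bochner_Integration.integral_cong) (auto simp: sp)
    also have "\<dots> = complex_of_real (measure (\<nu> h) T)" by (simp add: sp scaleR_conv_of_real)
    finally have "Re (q h z\<^sub>0) = Re (\<i> * complex_of_real (Im (q h z\<^sub>0)) + complex_of_real (measure (\<nu> h) T))"
      by (rule arg_cong)
    then have "measure (\<nu> h) T = Re (q h z\<^sub>0)" by simp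
    also have "\<dots> \<le> cmod (q h z\<^sub>0)" by (rule complex_Re_le_cmod)
    finally show ?thesis using norm_cinner_op_le[of "f z\<^sub>0" h] by (simp add: q_def)
  qed
  obtain E where E: "nonneg_op_measure T E"
    "\<And>A h. A \<in> sets (borel_on T) \<Longrightarrow> cinner (blinfun_apply (E A) h) h = complex_of_real (measure (\<nu> h) A)"
  proof -
    have "\<exists>E. nonneg_op_measure T E \<and> (\<forall>A\<in>sets (borel_on T). \<forall>h.
        cinner (blinfun_apply (E A) h) h = complex_of_real (measure (\<nu> h) A))"
    proof (rule nonneg_op_measure_of_measures[OF compact_imp_closed[OF T] fin sets])
      fix A h assume A: "A \<in> sets (borel_on T)"
      show "sesquilinear (\<lambda>h k. \<Sum>n<4. \<i> ^ n * complex_of_real (measure (\<nu> (polar_vec h k n)) A))"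
        using sesq[OF A] by (simp only: B_def)
      show "(\<Sum>n<4. \<i> ^ n * complex_of_real (measure (\<nu> (polar_vec h h n)) A)) =
          complex_of_real (measure (\<nu> h) A)"
        using diag[OF A, of h] by (simp only: B_def)
    next
      show "measure (\<nu> h) T \<le> (4 * norm (f z\<^sub>0)) * (norm h)\<^sup>2" for h by (rule bound)
    qed
    with that show ?thesis by blast
  qed
  have "diagonal_measure T E h = \<nu> h" for h
  proof (rule measure_eqI)
    show "sets (diagonal_measure T E h) = sets (\<nu> h)" by (simp add: sets diagonal_measure[OF E(1)])
    fix A assume "A \<in> sets (diagonal_measure T E h)"
    then have "A \<in> sets (borel_on T)" by (simp add: diagonal_measure[OF E(1)])
    from diagonal_measure(3)[OF E(1) this] E(2)[OF this]
    show "emeasure (diagonal_measure T E h) A = emeasure (\<nu> h) A"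
      by (simp add: finite_measure.emeasure_eq_measure[OF fin]
          finite_measure.emeasure_eq_measure[OF diagonal_measure(2)[OF E(1)]])
  qed
  then have "herglotz_op_rep \<Omega> T H z\<^sub>0 f E"
    using \<nu>(2) by (simp add: herglotz_op_rep_iff[OF ops E(1)] q_def[abs_def])
  with E(1) show ?thesis by blast
qed

text \<open>Scalar uniqueness identifies the diagonal measures, which determine the operators by
  polarization; extensionality settles the remaining sets.\<close>

lemma herglotz_op_rep_unique:
  assumes f: "f \<in> herglotz_op \<Omega>"
    and E: "nonneg_op_measure T E" "herglotz_op_rep \<Omega> T H z\<^sub>0 f E"
    and E': "nonneg_op_measure T E'" "herglotz_op_rep \<Omega> T H z\<^sub>0 f E'"
  shows "E = E'"
proof (rule extensionalityI)
  show "E \<in> extensional (sets (borel_on T))" "E' \<in> extensional (sets (borel_on T))"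
    using E(1) E'(1) by (simp_all add: nonneg_op_measure_def)
  have ops: "f \<in> \<Omega> \<rightarrow> bounded_ops" using f by (simp add: herglotz_op_def)
  have "diagonal_measure T E h = diagonal_measure T E' h" for h
    using E(2) E'(2) unfolding herglotz_op_rep_iff[OF ops E(1)] herglotz_op_rep_iff[OF ops E'(1)]
    by (intro herglotz_rep_unique[OF herglotz_cinner[OF f, of h]] diagonal_measure_borel E(1) E'(1)) auto
  then show "E A = E' A" if A: "A \<in> sets (borel_on T)" for A
    using diagonal_measure(3)[OF E(1) A] diagonal_measure(3)[OF E'(1) A]
    by (intro op_ext_diag nonneg_op_measureD(1)[OF E(1) A] nonneg_op_measureD(1)[OF E'(1) A]) metis
qed

text \<open>A Herglotz function with the same measure differs from the form of f only by an
  imaginary constant, so holomorphy and the sign of the real part carry over. For h = 0 the form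
  vanishes.\<close>

lemma herglotz_opI:
  fixes f :: "complex ^ 'd \<Rightarrow> 'h :: complex_hilbert_space \<Rightarrow>\<^sub>L 'h"
  assumes ops: "f \<in> \<Omega> \<rightarrow> bounded_ops"
    and E: "nonneg_op_measure T E" "herglotz_op_rep \<Omega> T H z\<^sub>0 f E"
    and M: "\<And>h. h \<noteq> 0 \<Longrightarrow> diagonal_measure T E h \<in> herglotz_measures \<Omega> T H z\<^sub>0"
  shows "f \<in> herglotz_op \<Omega>"
proof -
  define q where "q h z = cinner (blinfun_apply (f z) h) h" for h z
  have *: "holomorphic_several (q h) \<Omega> \<and> (\<forall>z\<in>\<Omega>. 0 \<le> Re (q h z))" for h
  proof (cases "h = 0")
    case True
    then have "q h = (\<lambda>z. 0)" by (simp add: q_def fun_eq_iff cinner_simps)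
    then show ?thesis by (auto simp: holomorphic_several_def intro!: exI[of _ "\<lambda>_. 0"])
  next
    case False
    obtain g where g: "g \<in> herglotz \<Omega>" "herglotz_rep \<Omega> H z\<^sub>0 g (diagonal_measure T E h)"
      using M[OF False] by (auto simp: herglotz_measures_def)
    have "herglotz_rep \<Omega> H z\<^sub>0 (q h) (diagonal_measure T E h)"
      using E(2) unfolding herglotz_op_rep_iff[OF ops E(1)] by (simp add: q_def[abs_def])
    then have eq: "q h z = g z + \<i> * complex_of_real (Im (q h z\<^sub>0) - Im (g z\<^sub>0))" if "z \<in> \<Omega>" for z
      using g(2) that by (simp add: herglotz_rep_def algebra_simps)
    have "holomorphic_several (q h) \<Omega>"
      unfolding holomorphic_several_def
    proof
      fix z assume z: "z \<in> \<Omega>"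
      then obtain D where D: "(g has_derivative D) (at z)" "\<forall>c v. D (c *s v) = c *\<^sub>C D v"
        using g(1) by (auto simp: herglotz_def holomorphic_several_def)
      have "((\<lambda>z. g z + \<i> * complex_of_real (Im (q h z\<^sub>0) - Im (g z\<^sub>0))) has_derivative D) (at z)"
        using has_derivative_add[OF D(1) has_derivative_const] by simp
      then have "(q h has_derivative D) (at z)"
        by (rule has_derivative_transform_within_open[OF _ \<Omega> z]) (simp add: eq)
      with D(2) show "\<exists>D. (q h has_derivative D) (at z) \<and> (\<forall>c v. D (c *s v) = c *\<^sub>C D v)" by blast
    qed
    moreover have "0 \<le> Re (q h z)" if "z \<in> \<Omega>" for z
      using g(1) that eq[OF that] by (simp add: herglotz_def)
    ultimately show ?thesis by blast
  qed
  have "holomorphic_several f \<Omega>"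
    by (rule holomorphic_several_opI[OF \<Omega> ops]) (use * in \<open>auto simp: q_def[abs_def]\<close>)
  moreover have "op_nonneg (op_Re (f z))" if z: "z \<in> \<Omega>" for z
  proof -
    have "f z \<in> bounded_ops" using ops z by auto
    then show ?thesis using * z by (simp add: op_nonneg_op_Re_iff q_def)
  qed
  ultimately show ?thesis using ops by (simp add: herglotz_op_def)
qed

end

theorem theorem4p4:
  fixes \<Omega> T :: "(complex ^ 'd) set"
    and z\<^sub>0 :: "complex ^ 'd"
    and H :: "complex ^ 'd \<Rightarrow> complex ^ 'd \<Rightarrow> complex"
    and f :: "complex ^ 'd \<Rightarrow> ('h :: complex_hilbert_space \<Rightarrow>\<^sub>L 'h)"
  assumes "open \<Omega>" and "connected \<Omega>" and "bounded \<Omega>"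
    and "closed T" and "T \<subseteq> frontier \<Omega>"
    and "z\<^sub>0 \<in> \<Omega>"
    and "\<forall>\<zeta>\<in>T. holomorphic_several (\<lambda>z. H z \<zeta>) \<Omega>"
    and "\<forall>z\<in>\<Omega>. continuous_on T (H z)"
    and "\<forall>\<zeta>\<in>T. H z\<^sub>0 \<zeta> = 1"
    and "\<forall>g\<in>herglotz \<Omega>. \<exists>!\<nu>. \<nu> \<in> borel_measures T \<and> herglotz_rep \<Omega> H z\<^sub>0 g \<nu>"
    and "f \<in> \<Omega> \<rightarrow> bounded_ops"
  shows "f \<in> herglotz_op \<Omega> \<longleftrightarrow>
      (\<exists>!E. nonneg_op_measure T E \<and> herglotz_op_rep \<Omega> T H z\<^sub>0 f E) \<and>
      (\<forall>E. nonneg_op_measure T E \<and> herglotz_op_rep \<Omega> T H z\<^sub>0 f E \<longrightarrow>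
        (\<forall>h. h \<noteq> 0 \<longrightarrow> diagonal_measure T E h \<in> herglotz_measures \<Omega> T H z\<^sub>0))"
proof
  \<comment> \<open>Compactness makes each continuous kernel \<open>H z\<close> bounded on
    \<open>T\<close>, hence integrable against finite measures.\<close>
  have "compact T"
    using assms(3-5)
    by (meson bounded_subset compact_eq_bounded_closed compact_frontier_bounded)
  note ctx = assms(1) this assms(6,8,9,10)
  {
    assume f: "f \<in> herglotz_op \<Omega>"
    have "\<exists>!E. nonneg_op_measure T E \<and> herglotz_op_rep \<Omega> T H z\<^sub>0 f E"
      using herglotz_op_rep_ex[OF ctx f] herglotz_op_rep_unique[OF ctx f] by blast
    moreover have "diagonal_measure T E h \<in> herglotz_measures \<Omega> T H z\<^sub>0"
      if "nonneg_op_measure T E" "herglotz_op_rep \<Omega> T H z\<^sub>0 f E" for E h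
      using that herglotz_cinner[OF f, of h] diagonal_measure_borel[OF that(1), of h]
      unfolding herglotz_op_rep_iff[OF ctx assms(11) that(1)] herglotz_measures_def by blast
    ultimately show "(\<exists>!E. nonneg_op_measure T E \<and> herglotz_op_rep \<Omega> T H z\<^sub>0 f E) \<and>
      (\<forall>E. nonneg_op_measure T E \<and> herglotz_op_rep \<Omega> T H z\<^sub>0 f E \<longrightarrow>
        (\<forall>h. h \<noteq> 0 \<longrightarrow> diagonal_measure T E h \<in> herglotz_measures \<Omega> T H z\<^sub>0))"
      by blast
  next
    assume "(\<exists>!E. nonneg_op_measure T E \<and> herglotz_op_rep \<Omega> T H z\<^sub>0 f E) \<and>
      (\<forall>E. nonneg_op_measure T E \<and> herglotz_op_rep \<Omega> T H z\<^sub>0 f E \<longrightarrow>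
        (\<forall>h. h \<noteq> 0 \<longrightarrow> diagonal_measure T E h \<in> herglotz_measures \<Omega> T H z\<^sub>0))"
    then obtain E where "nonneg_op_measure T E" "herglotz_op_rep \<Omega> T H z\<^sub>0 f E"
      "\<And>h. h \<noteq> 0 \<Longrightarrow> diagonal_measure T E h \<in> herglotz_measures \<Omega> T H z\<^sub>0"
      by blast
    then show "f \<in> herglotz_op \<Omega>"
      by (rule herglotz_opI[OF ctx assms(11)])
  }
qed

end
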